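(* Let $d\ge1$. There is a constant $K$ depending only on $d$ such that the following holds. Let $\mathbf S$ be a collection of tiles $s=W_s\times\Omega_s$ with $W_s\subset\mathbb R^d$, which is a disjoint union of subcollections $\{\mathbf C_I\mid I\in\mathbf I\}$, where $\mathbf I$ is a collection of subsets $I\subset\mathbb R^d$. Let $\{\varphi_s\mid s\in\mathbf S\}$ be adapted to $\mathbf S$ with constant $C_0$, so that for each $I\in\mathbf I$, $\{\varphi_s\mid s\in\mathbf C_I\}$ is a cluster with shadow $I$ (with constant $C_1$ independent of $I$). Suppose that (i) $\{\Omega_s\mid s\in\mathbf S\}$ is a grid; (ii) for all $s,s'\in\mathbf S$, $\Omega_{s'}\supset\Omega_s$ implies $W_{s'}-c(W_{s'})\subset W_s-c(W_s)$; (iii) for all $s\ne s'\in\mathbf S$ and $I\in\mathbf I$ with $s\in\mathbf C_I$, $\Omega_s\subset\Omega_{s'}$ implies $s'\in\mathbf C_I$ or $W_{s'}\cap I=\emptyset$. For $f\in L^2(\mathbb R^d)$ and $I\in\mathbf I$ define $$SQ(I,f)^2:=\frac1{|I|}\sum_{s\in\mathbf C_I}|\langle f,\varphi_s\rangle|^2 .$$ Let $\lambda>0$. If $SQ(I,f)\ge\lambda$ for all $I\in\mathbf I$ and $|\langle f,\varphi_s\rangle|\le 2\lambda\sqrt{|W_s|}$ for all $s\in\mathbf S$, then $$\sum_{I\in\mathbf I}|I|\le \lambda^{-2}K\bigl(1+C_1^{1/2}C_0^2\bigr)\|f\|_2^2 .$$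
   Context: For a set $W\subset\mathbb R^d$ of finite positive volume, $|W|$ is its Lebesgue measure, $c(W)$ is its center of mass, and for $\lambda>0$, $\lambda W:=\{c(W)+\lambda(x-c(W))\mid x\in W\}$ (dilation about the center of mass). $W$ is symmetric if $-(W-c(W))=W-c(W)$. Define $\sigma(x,W):=\inf\{a>0\mid x\in aW\}$ for $x\in\mathbb R^d$. A tile is a product $s=W_s\times\Omega_s$ of a symmetric convex set $W_s\subset\mathbb R^d$ (of finite positive volume) and a second set $\Omega_s$, which need not lie in $\mathbb R^d$; it may be a subset of some other arbitrary ambient set. Given a set of tiles $\mathbf S$, functions $\{\varphi_s\mid s\in\mathbf S\}$ are adapted to $\mathbf S$ (with constant $C_0$) if they are Schwartz functions on $\mathbb R^d$ and for all $s\in\mathbf S$: (1) $\|\varphi_s\|_2=1$; (2) $\langle\varphi_s,\varphi_{s'}\rangle=0$ whenever $s'\in\mathbf S$ and $\Omega_s\cap\Omega_{s'}=\emptyset$; (3) $|\varphi_s(x)|\le \dfrac{C_0}{\sqrt{|W_s|}}\,(1+\sigma(x,W_s))^{-2d-5}$ for all $x\in\mathbb R^d$. A collection of sets $\mathcal G$ is a grid if for all $G,G'\in\mathcal G$, $G\cap G'\in\{\emptyset,G,G'\}$. Let $\{\varphi_s\mid s\in\mathbf C\}$ be adapted to a set of tiles $\mathbf C$, and let $I\subset\mathbb R^d$ be a measurable set with $0<|I|<\infty$. Then $\{\varphi_s\mid s\in\mathbf C\}$ is a cluster with shadow $I$ (with constant $C_1$) if: (a) the tiles $s\in\mathbf C$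 are pairwise disjoint; (b) $W_s\subset I$ for all $s\in\mathbf C$; (c) for $s\ne s'\in\mathbf C$, $\Omega_s\cap\Omega_{s'}\neq\emptyset$ implies $\langle\varphi_s,\varphi_{s'}\rangle=0$; (d) $\displaystyle\sum_{s\in\mathbf C}|W_s|^{-1}\Bigl[\int_{I^c}(1+\sigma(x,W_s))^{-d-1}\,dx\Bigr]^2\le C_1|I|$, where $I^c=\mathbb R^d\setminus I$. The inner product and $\|\cdot\|_2$ are those of $L^2(\mathbb R^d)$. *)

theory Defs
  imports "HOL-Analysis.Analysis"
begin

section \<open>Dilations about the center of mass\<close>

definition center_of_mass :: "(real^'n) set \<Rightarrow> real^'n" where
  "center_of_mass W = (1 / measure lebesgue W) *\<^sub>R (LINT x:W|lebesgue. x)"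

definition dilate :: "real \<Rightarrow> (real^'n) set \<Rightarrow> (real^'n) set" where
  "dilate l W = (\<lambda>x. center_of_mass W + l *\<^sub>R (x - center_of_mass W)) ` W"

definition centered :: "(real^'n) set \<Rightarrow> (real^'n) set" where
  "centered W = (\<lambda>x. x - center_of_mass W) ` W"

definition symmetric :: "(real^'n) set \<Rightarrow> bool" where
  "symmetric W \<longleftrightarrow> uminus ` centered W = centered W"

definition \<sigma> :: "real^'n \<Rightarrow> (real^'n) set \<Rightarrow> real" where
  "\<sigma> x W = Inf {a. a > 0 \<and> x \<in> dilate a W}"


section \<open>Schwartz functions and the \<open>L\<^sup>2\<close> inner product\<close>

definition partial_deriv :: "'n::finite \<Rightarrow> (real^'n \<Rightarrow> complex) \<Rightarrow> real^'n \<Rightarrow> complex" where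
  "partial_deriv i f x = frechet_derivative f (at x) (axis i 1)"

text \<open>The iterated partial derivatives of \<open>f\<close> are indexed by lists of directions. All of them being
  differentiable means that \<open>f\<close> is of class \<open>C\<^sup>\<infinity>\<close>.\<close>

definition schwartz :: "(real^'n \<Rightarrow> complex) \<Rightarrow> bool" where
  "schwartz f \<longleftrightarrow>
     (\<forall>is. (\<forall>x. foldr partial_deriv is f differentiable (at x)) \<and>
           (\<forall>k::nat. bounded (range (\<lambda>x. norm x ^ k *\<^sub>R foldr partial_deriv is f x))))"

definition square_integrable :: "(real^'n \<Rightarrow> complex) \<Rightarrow> bool" where
  "square_integrable f \<longleftrightarrow>
     f \<in> borel_measurable lebesgue \<and> integrable lebesgue (\<lambda>x. (cmod (f x))\<^sup>2)"

definition l2_inner :: "(real^'n \<Rightarrow> complex) \<Rightarrow> (real^'n \<Rightarrow> complex) \<Rightarrow> complex" where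
  "l2_inner f g = (LINT x|lebesgue. f x * cnj (g x))"

definition l2_norm :: "(real^'n \<Rightarrow> complex) \<Rightarrow> real" where
  "l2_norm f = sqrt (LINT x|lebesgue. (cmod (f x))\<^sup>2)"


section \<open>Tiles, adapted functions, grids and clusters\<close>

text \<open>A tile \<open>W \<times> \<Omega>\<close> is represented by the pair of its factors. The product set determines the
  pair except when \<open>\<Omega>\<close> is empty, and that case cannot occur for a tile that carries an adapted
  function: condition (2) with \<open>s' = s\<close> would contradict condition (1).\<close>

type_synonym ('n, 'b) tile = "(real^'n) set \<times> 'b set"

abbreviation W_of :: "('n, 'b) tile \<Rightarrow> (real^'n) set" where
  "W_of s \<equiv> fst s"

abbreviation \<Omega>_of :: "('n, 'b) tile \<Rightarrow> 'b set" where
  "\<Omega>_of s \<equiv> snd s"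

definition tile_set :: "('n, 'b) tile \<Rightarrow> ((real^'n) \<times> 'b) set" where
  "tile_set s = W_of s \<times> \<Omega>_of s"

definition is_tile :: "('n::finite, 'b) tile \<Rightarrow> bool" where
  "is_tile s \<longleftrightarrow> convex (W_of s) \<and> symmetric (W_of s) \<and>
     W_of s \<in> lmeasurable \<and> 0 < measure lebesgue (W_of s)"

definition adapted ::
    "real \<Rightarrow> ('n::finite, 'b) tile set \<Rightarrow> (('n, 'b) tile \<Rightarrow> real^'n \<Rightarrow> complex) \<Rightarrow> bool" where
  "adapted C0 S \<phi> \<longleftrightarrow>
     (\<forall>s\<in>S. schwartz (\<phi> s) \<and>
            l2_norm (\<phi> s) = 1 \<and>
            (\<forall>s'\<in>S. \<Omega>_of s \<inter> \<Omega>_of s' = {} \<longrightarrow> l2_inner (\<phi> s) (\<phi> s') = 0) \<and>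
            (\<forall>x. cmod (\<phi> s x) \<le>
                   C0 / sqrt (measure lebesgue (W_of s)) / (1 + \<sigma> x (W_of s)) ^ (2 * CARD('n) + 5)))"

definition grid :: "'b set set \<Rightarrow> bool" where
  "grid \<G> \<longleftrightarrow> (\<forall>G\<in>\<G>. \<forall>G'\<in>\<G>. G \<inter> G' \<in> {{}, G, G'})"

definition cluster ::
    "real \<Rightarrow> real \<Rightarrow> ('n::finite, 'b) tile set \<Rightarrow> (('n, 'b) tile \<Rightarrow> real^'n \<Rightarrow> complex) \<Rightarrow>
     (real^'n) set \<Rightarrow> bool" where
  "cluster C0 C1 C \<phi> I \<longleftrightarrow>
     adapted C0 C \<phi> \<and>
     I \<in> lmeasurable \<and> 0 < measure lebesgue I \<and>
     (\<forall>s\<in>C. \<forall>s'\<in>C. s \<noteq> s' \<longrightarrow> tile_set s \<inter> tile_set s' = {}) \<and>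
     (\<forall>s\<in>C. W_of s \<subseteq> I) \<and>
     (\<forall>s\<in>C. \<forall>s'\<in>C. s \<noteq> s' \<longrightarrow> \<Omega>_of s \<inter> \<Omega>_of s' \<noteq> {} \<longrightarrow> l2_inner (\<phi> s) (\<phi> s') = 0) \<and>
     (\<Sum>\<^sub>\<infinity>s\<in>C. (\<integral>\<^sup>+x\<in>- I. ennreal (1 / (1 + \<sigma> x (W_of s)) ^ (CARD('n) + 1)) \<partial>lebesgue)\<^sup>2
               / ennreal (measure lebesgue (W_of s)))
       \<le> ennreal (C1 * measure lebesgue I)"

text \<open>The functions of a cluster are orthonormal, so by Bessel's inequality the following sum
  converges for every square integrable \<open>f\<close>.\<close>

definition SQ ::
    "('n, 'b) tile set \<Rightarrow> (('n, 'b) tile \<Rightarrow> real^'n \<Rightarrow> complex) \<Rightarrow> (real^'n) set \<Rightarrow>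
     (real^'n \<Rightarrow> complex) \<Rightarrow> real" where
  "SQ C \<phi> I f = sqrt (1 / measure lebesgue I * (\<Sum>\<^sub>\<infinity>s\<in>C. (cmod (l2_inner f (\<phi> s)))\<^sup>2))"


section \<open>The estimate\<close>

text \<open>\<open>K\<close> is an admissible constant in dimension \<open>CARD('n)\<close> for tiles whose second factors are
  subsets of the ambient set \<open>UNIV :: 'b set\<close>. All other data are quantified inside, so that \<open>K\<close>
  cannot depend on them. The sum of the volumes is taken in the extended nonnegative reals, so that
  its finiteness is part of the claim.

  A constant that depends only on the dimension has to be admissible for all ambient types \<open>'b\<close> at
  once. A formula cannot quantify over types, and an existential statement at type \<open>'b\<close> alone would
  allow \<open>K\<close> to vary with \<open>'b\<close>. Independence of the ambient set can be expressed by the additional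
  claim that every \<open>K\<close> admissible for \<open>nat\<close> is admissible for \<open>'b\<close>, with \<open>'b\<close> arbitrary.\<close>

definition cluster_estimate :: "'n::finite itself \<Rightarrow> 'b itself \<Rightarrow> real \<Rightarrow> bool" where
  "cluster_estimate _ _ K \<longleftrightarrow>
    (\<forall>(S :: ('n, 'b) tile set) (\<I> :: (real^'n) set set) (C :: (real^'n) set \<Rightarrow> ('n, 'b) tile set)
       (\<phi> :: ('n, 'b) tile \<Rightarrow> real^'n \<Rightarrow> complex) (C0 :: real) (C1 :: real)
       (f :: real^'n \<Rightarrow> complex) (lam :: real).
       (\<forall>s\<in>S. is_tile s) \<and>
       S = (\<Union>I\<in>\<I>. C I) \<and> disjoint_family_on C \<I> \<and>
       adapted C0 S \<phi> \<and>
       0 \<le> C1 \<and> (\<forall>I\<in>\<I>. cluster C0 C1 (C I) \<phi> I) \<and>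
       grid (\<Omega>_of ` S) \<and>
       (\<forall>s\<in>S. \<forall>s'\<in>S. \<Omega>_of s \<subseteq> \<Omega>_of s' \<longrightarrow> centered (W_of s') \<subseteq> centered (W_of s)) \<and>
       (\<forall>s\<in>S. \<forall>s'\<in>S. \<forall>I\<in>\<I>. s \<noteq> s' \<longrightarrow> s \<in> C I \<longrightarrow> \<Omega>_of s \<subseteq> \<Omega>_of s' \<longrightarrow>
          s' \<in> C I \<or> W_of s' \<inter> I = {}) \<and>
       square_integrable f \<and>
       0 < lam \<and>
       (\<forall>I\<in>\<I>. lam \<le> SQ (C I) \<phi> I f) \<and>
       (\<forall>s\<in>S. cmod (l2_inner f (\<phi> s)) \<le> 2 * lam * sqrt (measure lebesgue (W_of s)))
       \<longrightarrow>
       (\<Sum>\<^sub>\<infinity>I\<in>\<I>. emeasure lebesgue I)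
         \<le> ennreal (1 / lam\<^sup>2 * K * (1 + sqrt C1 * C0\<^sup>2) * (l2_norm f)\<^sup>2))"

end

theory Submission
  imports Defs
begin

text \<open>Let \<open>a s\<close> be the coefficient \<open>\<langle>f, \<phi> s\<rangle>\<close>. Since the square function is at least \<open>\<lambda>\<close> on every shadow,
  any finitely many shadows have total volume at most \<open>2 \<lambda>\<^sup>-\<^sup>2 B\<close>, where \<open>B\<close> is the sum of \<open>|a s|\<^sup>2\<close> over finitely
  many tiles (\<open>finite_energy\<close>). It remains to bound \<open>B\<close> by a multiple of \<open>\<parallel>f\<parallel>\<^sup>2\<close>. By
  \<open>almost_orthogonal_bessel\<close> this follows once \<open>\<Sum>s t. |a s| |a t| |\<langle>\<phi> s, \<phi> t\<rangle>|\<close> is at most a multiple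
  of \<open>B\<close>.

  The diagonal contributes \<open>B\<close>. Off the diagonal only tiles of different clusters with nested frequency
  sets interact, say \<open>\<Omega>\<^sub>s \<subseteq> \<Omega>\<^sub>t\<close> (\<open>correlated_above\<close>). Then \<open>W\<^sub>t\<close> is, up to translation, contained in \<open>W\<^sub>s\<close>,
  and the decay of the functions gives \<open>|\<langle>\<phi> s, \<phi> t\<rangle>| \<le> c C\<^sub>0\<^sup>2 (|W\<^sub>t| / |W\<^sub>s|)\<^sup>1\<^sup>/\<^sup>2 (1 + \<sigma>(x, W\<^sub>s))\<^sup>-\<^sup>d\<^sup>-\<^sup>1\<close>
  for all \<open>x\<close> in \<open>W\<^sub>t\<close> (\<open>l2_inner_decay\<close>, \<open>weight_le\<close>). Together with \<open>|a t| \<le> 2 \<lambda> |W\<^sub>t|\<^sup>1\<^sup>/\<^sup>2\<close> this bounds the term of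
  \<open>t\<close> by an integral over \<open>W\<^sub>t\<close>. For fixed \<open>s\<close> the sets \<open>W\<^sub>t\<close> are pairwise disjoint and avoid the shadow
  of \<open>s\<close> (\<open>above_disjoint\<close>, \<open>W_outside_shadow\<close>), so that the sum over \<open>t\<close> is at most the integral over the
  complement of the shadow which the cluster condition controls in square mean. Cauchy-Schwarz over \<open>s\<close>
  yields a bound by a multiple of \<open>C\<^sub>0\<^sup>2 \<lambda> (B C\<^sub>1 N)\<^sup>1\<^sup>/\<^sup>2\<close>, with \<open>N\<close> the total volume of the shadows, and \<open>\<lambda>\<^sup>2 N \<le> 2 B\<close> turns
  this into a multiple of \<open>B\<close> (\<open>gram_le\<close>).

  That a constant for frequency sets in \<open>nat\<close> serves for every ambient set is a reduction to countably
  many tiles: only intersections and inclusions of the frequency sets matter, and for countably many sets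
  these are witnessed by countably many points (\<open>encode_countable_family\<close>).\<close>

section \<open>The gauge of a tile\<close>

text \<open>A convex set of positive volume has interior points. If \<open>v\<close> is one of them after centering,
  then by symmetry so is \<open>-v\<close>, and the midpoint of the two is the origin.\<close>

lemma zero_in_interior_centered:
  assumes "is_tile s"
  shows "0 \<in> interior (centered (W_of s))"
proof -
  have W: "convex (W_of s)" "symmetric (W_of s)" "measure lebesgue (W_of s) \<noteq> 0"
    using assms by (auto simp: is_tile_def)
  have "interior (W_of s) \<noteq> {}"
    using W negligible_convex_interior[of "W_of s"] by (auto simp: negligible_iff_measure)
  then obtain v where v: "v \<in> interior (centered (W_of s))"
    by (force simp: centered_def interior_translation_subtract)
  have "- v \<in> interior (uminus ` centered (W_of s))"
    using v by (simp add: interior_negations)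
  then have "- v \<in> interior (centered (W_of s))"
    using W(2) by (simp add: symmetric_def)
  moreover have "convex (interior (centered (W_of s)))"
    unfolding centered_def using W(1) by (intro convex_interior) simp
  ultimately have "(1/2) *\<^sub>R v + (1/2) *\<^sub>R (- v) \<in> interior (centered (W_of s))"
    using v by (intro convexD) auto
  then show ?thesis by simp
qed

lemma convex_centered: "is_tile s \<Longrightarrow> convex (centered (W_of s))"
  by (simp add: is_tile_def centered_def)

lemma minus_mem_centered:
  assumes "is_tile s" "v \<in> centered (W_of s)"
  shows "- v \<in> centered (W_of s)"
  using assms by (metis image_eqI is_tile_def symmetric_def)

lemma mem_dilate_iff:
  assumes "a > 0"
  shows "x \<in> dilate a W \<longleftrightarrow> (1 / a) *\<^sub>R (x - center_of_mass W) \<in> centered W"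
proof
  assume "x \<in> dilate a W"
  then show "(1 / a) *\<^sub>R (x - center_of_mass W) \<in> centered W"
    using assms by (auto simp: dilate_def centered_def)
next
  assume "(1 / a) *\<^sub>R (x - center_of_mass W) \<in> centered W"
  then obtain w where w: "w \<in> W" "(1 / a) *\<^sub>R (x - center_of_mass W) = w - center_of_mass W"
    by (auto simp: centered_def)
  have "x - center_of_mass W = a *\<^sub>R (w - center_of_mass W)"
    using assms unfolding w(2)[symmetric] by simp
  then have "x = center_of_mass W + a *\<^sub>R (w - center_of_mass W)"
    by (simp add: algebra_simps)
  then show "x \<in> dilate a W"
    using w(1) by (auto simp: dilate_def)
qed

text \<open>The dilates of a neighbourhood of the center already exhaust the space. Hence \<open>\<sigma>\<close> is the infimum of
  a nonempty set.\<close>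

lemma dilates_exhaust:
  assumes "is_tile s"
  obtains a where "a > 0" "x \<in> dilate a (W_of s)"
proof -
  let ?z = "x - center_of_mass (W_of s)"
  obtain e where e: "e > 0" "ball 0 e \<subseteq> centered (W_of s)"
    using zero_in_interior_centered[OF assms] by (auto simp: mem_interior)
  define a where "a = (norm ?z + 1) / e"
  have a: "a > 0"
    using e(1) by (simp add: a_def add_nonneg_pos)
  have "norm ((1 / a) *\<^sub>R ?z) = e * norm ?z / (norm ?z + 1)"
    using e(1) by (simp add: a_def add_nonneg_pos abs_of_pos)
  also have "\<dots> < e"
    using e(1) by (simp add: divide_less_eq add_nonneg_pos)
  finally have "(1 / a) *\<^sub>R ?z \<in> centered (W_of s)"
    using e(2) by (auto simp: dist_norm)
  then show ?thesis
    using that a mem_dilate_iff by blast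
qed

lemma \<sigma>_nonneg: "is_tile s \<Longrightarrow> 0 \<le> \<sigma> x (W_of s)"
  unfolding \<sigma>_def by (rule cInf_greatest) (use dilates_exhaust[of s x] in auto)

lemma \<sigma>_le: "0 < a \<Longrightarrow> x \<in> dilate a W \<Longrightarrow> \<sigma> x W \<le> a"
  unfolding \<sigma>_def by (rule cInf_lower) (auto intro: bdd_belowI[of _ 0])

text \<open>The dilates of a convex set that contains its center increase, so that membership in \<open>dilate a W\<close>
  holds for every \<open>a\<close> above the infimum.\<close>

lemma mem_dilate_if_\<sigma>_less:
  assumes "is_tile s" "\<sigma> x (W_of s) < a"
  shows "x \<in> dilate a (W_of s)"
proof -
  let ?c = "center_of_mass (W_of s)"
  have "{a. a > 0 \<and> x \<in> dilate a (W_of s)} \<noteq> {}"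
    using dilates_exhaust[OF assms(1)] by blast
  then obtain b where b: "b > 0" "x \<in> dilate b (W_of s)" "b < a"
    using cInf_lessD[of "{a. a > 0 \<and> x \<in> dilate a (W_of s)}" a] assms(2) by (auto simp: \<sigma>_def)
  have "(1 / b) *\<^sub>R (x - ?c) \<in> centered (W_of s)"
    using b by (simp add: mem_dilate_iff)
  moreover have "0 \<in> centered (W_of s)"
    using zero_in_interior_centered[OF assms(1)] interior_subset by blast
  ultimately have "(b / a) *\<^sub>R ((1 / b) *\<^sub>R (x - ?c)) + (1 - b / a) *\<^sub>R 0 \<in> centered (W_of s)"
    using b convex_centered[OF assms(1)] by (intro convexD) auto
  then show ?thesis
    using b by (simp add: mem_dilate_iff)
qed

lemma \<sigma>_le_1: "x \<in> W \<Longrightarrow> \<sigma> x W \<le> 1"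
  by (rule \<sigma>_le) (auto simp: dilate_def)

lemma \<sigma>_center:
  assumes "is_tile s"
  shows "\<sigma> (center_of_mass (W_of s)) (W_of s) = 0"
proof (rule antisym)
  have "0 \<in> centered (W_of s)"
    using zero_in_interior_centered[OF assms] interior_subset by blast
  then have "center_of_mass (W_of s) \<in> dilate a (W_of s)" if "a > 0" for a
    using that by (simp add: mem_dilate_iff)
  then show "\<sigma> (center_of_mass (W_of s)) (W_of s) \<le> 0"
    using field_le_epsilon[of _ 0] \<sigma>_le by (metis add_0)
qed (rule \<sigma>_nonneg[OF assms])

text \<open>A triangle inequality for two gauges: the gauge of the smaller body \<open>W'\<close> dominates the gauge of
  \<open>W\<close>, so the displacement from \<open>x\<close> to \<open>y\<close>, measured by \<open>W\<close>, is at most the displacement from \<open>x\<close> to the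
  center of \<open>W'\<close> and on to \<open>y\<close>, measured by \<open>W'\<close>.\<close>

lemma \<sigma>_triangle:
  assumes s: "is_tile s" and t: "is_tile t"
    and sub: "centered (W_of t) \<subseteq> centered (W_of s)"
  shows "\<sigma> y (W_of s) \<le> \<sigma> x (W_of s) + \<sigma> x (W_of t) + \<sigma> y (W_of t)"
proof (rule field_le_epsilon)
  fix e :: real assume e: "0 < e"
  define a where "a = \<sigma> x (W_of s) + e / 3"
  define b where "b = \<sigma> x (W_of t) + e / 3"
  define b' where "b' = \<sigma> y (W_of t) + e / 3"
  have pos: "a > 0" "b > 0" "b' > 0"
    using e \<sigma>_nonneg[OF s, of x] \<sigma>_nonneg[OF t, of x] \<sigma>_nonneg[OF t, of y]
    by (auto simp: a_def b_def b'_def)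
  have "x \<in> dilate a (W_of s)" "x \<in> dilate b (W_of t)" "y \<in> dilate b' (W_of t)"
    using e by (auto simp: a_def b_def b'_def intro!: mem_dilate_if_\<sigma>_less s t)
  then obtain u v w where uvw: "u \<in> centered (W_of s)" "v \<in> centered (W_of t)" "w \<in> centered (W_of t)"
    and eqs: "u = (1 / a) *\<^sub>R (x - center_of_mass (W_of s))"
      "v = (1 / b) *\<^sub>R (x - center_of_mass (W_of t))"
      "w = (1 / b') *\<^sub>R (y - center_of_mass (W_of t))"
    using pos by (simp add: mem_dilate_iff)
  let ?r = "a + b + b'"
  have "- v \<in> centered (W_of s)" "w \<in> centered (W_of s)"
    using minus_mem_centered[OF t] uvw sub by auto
  then have "(b / (b + b')) *\<^sub>R (- v) + (b' / (b + b')) *\<^sub>R w \<in> centered (W_of s)"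
    using pos by (intro convexD[OF convex_centered[OF s]]) (auto simp: add_divide_distrib[symmetric])
  then have "(a / ?r) *\<^sub>R u + ((b + b') / ?r) *\<^sub>R ((b / (b + b')) *\<^sub>R (- v) + (b' / (b + b')) *\<^sub>R w)
      \<in> centered (W_of s)"
    by (rule convexD[OF convex_centered[OF s] uvw(1)])
       (use pos in \<open>auto simp: add_divide_distrib[symmetric]\<close>)
  moreover have "((b + b') / ?r) *\<^sub>R ((b / (b + b')) *\<^sub>R (- v) + (b' / (b + b')) *\<^sub>R w)
      = (b / ?r) *\<^sub>R (- v) + (b' / ?r) *\<^sub>R w"
    unfolding scaleR_add_right scaleR_scaleR using pos by simp
  then have "(a / ?r) *\<^sub>R u + ((b + b') / ?r) *\<^sub>R ((b / (b + b')) *\<^sub>R (- v) + (b' / (b + b')) *\<^sub>R w)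
      = (1 / ?r) *\<^sub>R (a *\<^sub>R u - b *\<^sub>R v + b' *\<^sub>R w)"
    by (simp add: scaleR_add_right scaleR_diff_right)
  moreover have "a *\<^sub>R u - b *\<^sub>R v + b' *\<^sub>R w = y - center_of_mass (W_of s)"
    using pos by (simp add: eqs)
  ultimately have "y \<in> dilate ?r (W_of s)"
    using pos by (simp add: mem_dilate_iff)
  then have "\<sigma> y (W_of s) \<le> ?r"
    using pos by (intro \<sigma>_le) auto
  then show "\<sigma> y (W_of s) \<le> \<sigma> x (W_of s) + \<sigma> x (W_of t) + \<sigma> y (W_of t) + e"
    by (simp add: a_def b_def b'_def)
qed


section \<open>Correlation of two wave packets\<close>

definition zeta2 :: real where
  "zeta2 = (\<Sum>k. 1 / (real k + 1)\<^sup>2)"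

lemma summable_zeta2: "summable (\<lambda>k. 1 / (real k + 1)\<^sup>2)"
  using iffD2[OF summable_Suc_iff inverse_power_summable[of 2, where 'a=real]]
  by (simp add: inverse_eq_divide add.commute)

lemma zeta2_ge_1: "1 \<le> zeta2"
  using sum_le_suminf[OF summable_zeta2, of "{0}"] by (simp add: zeta2_def)

lemma emeasure_dilate:
  fixes W :: "(real^'n) set"
  assumes "0 \<le> a"
  shows "emeasure lebesgue (dilate a W) = ennreal (a ^ CARD('n)) * emeasure lebesgue W"
proof -
  have "dilate a W = (\<lambda>x. a *\<^sub>R x + (center_of_mass W - a *\<^sub>R center_of_mass W)) ` W"
    by (simp add: dilate_def algebra_simps)
  then show ?thesis
    using assms emeasure_lebesgue_affine[of a _ W] by (simp add: ennreal_power)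
qed

lemma sets_dilate:
  assumes "W \<in> sets lebesgue"
  shows "dilate a W \<in> sets lebesgue"
proof -
  have "dilate a W = (+) (center_of_mass W - a *\<^sub>R center_of_mass W) ` ((\<lambda>x. a *\<^sub>R x) ` W)"
    by (simp add: dilate_def image_image algebra_simps)
  moreover have "(\<lambda>x. a *\<^sub>R x) ` W \<in> sets lebesgue"
    by (rule differentiable_image_in_sets_lebesgue[OF assms])
       (auto intro: differentiable_on_eq_differentiable_at derivative_intros)
  ultimately show ?thesis
    by (simp add: lebesgue_sets_translation)
qed

text \<open>On the shell \<open>k \<le> \<sigma> < k + 1\<close> the integrand is at most \<open>(k + 1) ^ - (d + 2)\<close>, and the shell lies in a
  dilate of volume \<open>(k + 1) ^ d * |W|\<close>. Two powers are left to sum over \<open>k\<close>.\<close>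

lemma nn_integral_decay_le:
  fixes s :: "('n::finite, 'b) tile"
  assumes s: "is_tile s" and Q: "0 \<le> Q"
    and g: "\<And>x. g x \<le> Q / (1 + \<sigma> x (W_of s)) ^ (CARD('n) + 2)"
  shows "(\<integral>\<^sup>+x. ennreal (g x) \<partial>lebesgue) \<le> ennreal (Q * zeta2 * measure lebesgue (W_of s))"
proof -
  let ?d = "CARD('n)" and ?W = "W_of s"
  have W: "?W \<in> lmeasurable"
    using s by (simp add: is_tile_def)
  let ?h = "\<lambda>k x. ennreal (Q / (real k + 1) ^ (?d + 2)) * indicator (dilate (real k + 1) ?W) x"
  have "ennreal (g x) \<le> (\<Sum>k. ?h k x)" for x
  proof -
    define k where "k = nat \<lfloor>\<sigma> x ?W\<rfloor>"
    have k: "real k \<le> \<sigma> x ?W" "\<sigma> x ?W < real k + 1"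
      using \<sigma>_nonneg[OF s, of x] unfolding k_def by linarith+
    have "g x \<le> Q / (1 + \<sigma> x ?W) ^ (?d + 2)"
      by (rule g)
    also have "\<dots> \<le> Q / (real k + 1) ^ (?d + 2)"
      using k Q by (intro divide_left_mono power_mono mult_pos_pos zero_less_power) auto
    finally have "ennreal (g x) \<le> (\<Sum>j\<in>{k}. ?h j x)"
      using k mem_dilate_if_\<sigma>_less[OF s] by (auto intro: ennreal_leI)
    also have "\<dots> \<le> (\<Sum>k. ?h k x)"
      by (rule sum_le_suminf) auto
    finally show ?thesis .
  qed
  then have "(\<integral>\<^sup>+x. ennreal (g x) \<partial>lebesgue) \<le> (\<integral>\<^sup>+x. (\<Sum>k. ?h k x) \<partial>lebesgue)"
    by (intro nn_integral_mono)
  also have "\<dots> = (\<Sum>k. \<integral>\<^sup>+x. ?h k x \<partial>lebesgue)"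
    using W by (intro nn_integral_suminf borel_measurable_times_ennreal borel_measurable_indicator)
      (auto simp: sets_dilate fmeasurableD)
  also have "\<dots> = (\<Sum>k. ennreal (Q * (1 / (real k + 1)\<^sup>2) * measure lebesgue ?W))"
  proof (rule suminf_cong)
    fix k
    have "(\<integral>\<^sup>+x. ?h k x \<partial>lebesgue)
        = ennreal (Q / (real k + 1) ^ (?d + 2)) * emeasure lebesgue (dilate (real k + 1) ?W)"
      using W by (intro nn_integral_cmult_indicator) (auto simp: sets_dilate fmeasurableD)
    also have "\<dots> = ennreal (Q / (real k + 1) ^ (?d + 2) * ((real k + 1) ^ ?d * measure lebesgue ?W))"
      by (simp only: emeasure_dilate emeasure_eq_measure2[OF W] ennreal_mult'[symmetric]
            ennreal_mult''[symmetric] measure_nonneg zero_le_power of_nat_0_le_iff add_nonneg_nonneg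
            zero_le_one mult_nonneg_nonneg)
    also have "Q / (real k + 1) ^ (?d + 2) * ((real k + 1) ^ ?d * measure lebesgue ?W)
        = Q * (1 / (real k + 1)\<^sup>2) * measure lebesgue ?W"
      by (simp add: power_add power2_eq_square)
    finally show "(\<integral>\<^sup>+x. ?h k x \<partial>lebesgue)
        = ennreal (Q * (1 / (real k + 1)\<^sup>2) * measure lebesgue ?W)" .
  qed
  also have "\<dots> = ennreal (\<Sum>k. Q * (1 / (real k + 1)\<^sup>2) * measure lebesgue ?W)"
    using Q summable_zeta2 by (intro suminf_ennreal2 summable_mult2 summable_mult) auto
  also have "(\<Sum>k. Q * (1 / (real k + 1)\<^sup>2) * measure lebesgue ?W) = Q * zeta2 * measure lebesgue ?W"
    unfolding zeta2_def using summable_zeta2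
    by (simp only: suminf_mult2[symmetric] suminf_mult[symmetric] summable_mult)
  finally show ?thesis .
qed

lemma decay_powers:
  fixes A B D :: real
  assumes A: "1 \<le> A" and B: "1 \<le> B" and D: "1 \<le> D" and AB: "D \<le> A * B"
  shows "D ^ (d + 1) * B ^ (d + 2) \<le> A ^ (2 * d + 5) * B ^ (2 * d + 5)"
proof -
  have "D ^ (d + 1) * B ^ (d + 2) \<le> (A * B) ^ (d + 1) * B ^ (d + 2)"
    using AB D B by (intro mult_right_mono power_mono) auto
  also have "\<dots> = A ^ (d + 1) * B ^ ((d + 1) + (d + 2))"
    by (simp only: power_mult_distrib power_add[of B "d + 1"] mult.assoc)
  also have "\<dots> \<le> A ^ (2 * d + 5) * B ^ (2 * d + 5)"
    using A B by (intro mult_mono power_increasing zero_le_power) auto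
  finally show ?thesis .
qed

text \<open>Let \<open>c\<close> be the center of the smaller body \<open>W'\<close>. By the triangle inequality the product of the two
  decay factors \<open>1 + \<sigma>\<close> is at least \<open>1 + \<sigma> c W\<close> at every point. This pays for \<open>d + 1\<close> powers, and the
  remaining powers of \<open>1 + \<sigma> x W'\<close> are integrable.\<close>

lemma l2_inner_decay:
  fixes s t :: "('n::finite, 'b) tile"
  assumes s: "is_tile s" and t: "is_tile t"
    and sub: "centered (W_of t) \<subseteq> centered (W_of s)"
    and \<phi>: "\<And>x. cmod (\<phi> x) \<le>
      C0 / sqrt (measure lebesgue (W_of s)) / (1 + \<sigma> x (W_of s)) ^ (2 * CARD('n) + 5)"
    and \<psi>: "\<And>x. cmod (\<psi> x) \<le>
      C0 / sqrt (measure lebesgue (W_of t)) / (1 + \<sigma> x (W_of t)) ^ (2 * CARD('n) + 5)"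
  shows "cmod (l2_inner \<phi> \<psi>) \<le> zeta2 * C0\<^sup>2 * sqrt (measure lebesgue (W_of t))
    / sqrt (measure lebesgue (W_of s))
    / (1 + \<sigma> (center_of_mass (W_of t)) (W_of s)) ^ (CARD('n) + 1)"
proof -
  let ?d = "CARD('n)" and ?v = "measure lebesgue (W_of s)" and ?w = "measure lebesgue (W_of t)"
  define D where "D = 1 + \<sigma> (center_of_mass (W_of t)) (W_of s)"
  define Q where "Q = C0\<^sup>2 / (sqrt ?v * sqrt ?w) / D ^ (?d + 1)"
  have D: "D \<ge> 1"
    using \<sigma>_nonneg[OF s] by (simp add: D_def)
  have Q: "Q \<ge> 0"
    using D by (simp add: Q_def)
  have vw: "?v > 0" "?w > 0"
    using s t by (auto simp: is_tile_def)
  have ptw: "cmod (\<phi> x * cnj (\<psi> x)) \<le> Q * (1 / (1 + \<sigma> x (W_of t)) ^ (?d + 2))" for x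
  proof -
    let ?A = "1 + \<sigma> x (W_of s)" and ?B = "1 + \<sigma> x (W_of t)"
    have A: "?A \<ge> 1" and B: "?B \<ge> 1"
      using \<sigma>_nonneg[OF s] \<sigma>_nonneg[OF t] by auto
    have "D \<le> ?A + \<sigma> x (W_of t)"
      using \<sigma>_triangle[OF s t sub, of "center_of_mass (W_of t)" x] \<sigma>_center[OF t]
      by (simp add: D_def)
    also have "\<dots> \<le> ?A * ?B"
      using mult_nonneg_nonneg[OF \<sigma>_nonneg[OF s, of x] \<sigma>_nonneg[OF t, of x]]
      by (simp add: algebra_simps)
    finally have AB: "D ^ (?d + 1) * ?B ^ (?d + 2) \<le> ?A ^ (2 * ?d + 5) * ?B ^ (2 * ?d + 5)"
      by (rule decay_powers[OF A B D])
    have "cmod (\<phi> x * cnj (\<psi> x)) = cmod (\<phi> x) * cmod (\<psi> x)"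
      by (simp add: norm_mult)
    also have "\<dots> \<le> (C0 / sqrt ?v / ?A ^ (2 * ?d + 5)) * (C0 / sqrt ?w / ?B ^ (2 * ?d + 5))"
      by (rule mult_mono[OF \<phi> \<psi> order_trans[OF norm_ge_zero \<phi>] norm_ge_zero])
    also have "\<dots> = C0\<^sup>2 / (sqrt ?v * sqrt ?w) * (1 / (?A ^ (2 * ?d + 5) * ?B ^ (2 * ?d + 5)))"
      by (simp add: power2_eq_square)
    also have "\<dots> \<le> C0\<^sup>2 / (sqrt ?v * sqrt ?w) * (1 / (D ^ (?d + 1) * ?B ^ (?d + 2)))"
    proof (rule mult_left_mono)
      show "1 / (?A ^ (2 * ?d + 5) * ?B ^ (2 * ?d + 5)) \<le> 1 / (D ^ (?d + 1) * ?B ^ (?d + 2))"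
        by (rule divide_left_mono[OF AB]) (use A B D in \<open>auto intro!: mult_pos_pos zero_less_power\<close>)
    qed (simp only: zero_le_divide_iff zero_le_power2 mult_nonneg_nonneg real_sqrt_ge_zero measure_nonneg simp_thms)
    also have "\<dots> = Q * (1 / ?B ^ (?d + 2))"
      by (simp only: Q_def divide_divide_eq_left times_divide_eq_right mult_1_right)
    finally show ?thesis .
  qed
  have "ennreal (cmod (l2_inner \<phi> \<psi>)) \<le> (\<integral>\<^sup>+x. ennreal (cmod (\<phi> x * cnj (\<psi> x))) \<partial>lebesgue)"
    unfolding l2_inner_def
    by (cases "integrable lebesgue (\<lambda>x. \<phi> x * cnj (\<psi> x))")
       (auto simp: integral_norm_bound_ennreal not_integrable_integral_eq)
  also have "\<dots> \<le> ennreal (Q * zeta2 * ?w)"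
    using ptw by (intro nn_integral_decay_le t Q) simp
  finally have "cmod (l2_inner \<phi> \<psi>) \<le> Q * zeta2 * ?w"
    using Q zeta2_ge_1 by (subst (asm) ennreal_le_iff) auto
  also have "Q * zeta2 * ?w = zeta2 * C0\<^sup>2 * (?w / sqrt ?w) / sqrt ?v / D ^ (?d + 1)"
    by (simp add: Q_def mult_ac)
  also have "?w / sqrt ?w = sqrt ?w"
    using vw by (simp add: real_div_sqrt)
  finally show ?thesis
    by (simp add: D_def)
qed


section \<open>Almost orthogonality\<close>

lemma square_integrable_mult:
  assumes "square_integrable f" "square_integrable g"
  shows "integrable lebesgue (\<lambda>x. f x * cnj (g x))"
proof (rule Bochner_Integration.integrable_bound)
  show "integrable lebesgue (\<lambda>x. (cmod (f x))\<^sup>2 + (cmod (g x))\<^sup>2)"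
    using assms by (auto simp: square_integrable_def)
  have meas: "f \<in> borel_measurable lebesgue" "g \<in> borel_measurable lebesgue"
    using assms by (auto simp: square_integrable_def)
  have "(\<lambda>x. cnj (g x)) \<in> borel_measurable lebesgue"
    by (rule measurable_compose[OF meas(2) borel_measurable_continuous_onI]) (intro continuous_intros)
  then show "(\<lambda>x. f x * cnj (g x)) \<in> borel_measurable lebesgue"
    by (rule borel_measurable_times[OF meas(1)])
  have "cmod (f x) * cmod (g x) \<le> (cmod (f x))\<^sup>2 + (cmod (g x))\<^sup>2" for x
    using sum_squares_bound[of "cmod (f x)" "cmod (g x)"]
      mult_nonneg_nonneg[OF norm_ge_zero[of "f x"] norm_ge_zero[of "g x"]] by linarith
  then show "AE x in lebesgue. norm (f x * cnj (g x)) \<le> norm ((cmod (f x))\<^sup>2 + (cmod (g x))\<^sup>2)"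
    by (simp add: norm_mult)
qed

lemma l2_norm_squared: "(l2_norm f)\<^sup>2 = (LINT x|lebesgue. (cmod (f x))\<^sup>2)"
  by (simp add: l2_norm_def)

lemma l2_inner_self: "l2_inner f f = complex_of_real ((l2_norm f)\<^sup>2)"
  by (simp add: l2_inner_def l2_norm_squared complex_norm_square[symmetric] of_real_power[symmetric]
        del: of_real_power)

lemma l2_inner_commute: "l2_inner g f = cnj (l2_inner f g)"
  unfolding l2_inner_def by (subst Bochner_Integration.integral_cnj[symmetric]) (simp add: mult.commute)

text \<open>Bessel's inequality with a loss \<open>M\<close>, where the Gram matrix is tested only on the coefficients
  \<open>a s = \<langle>f, \<phi> s\<rangle>\<close> themselves. The proof expands \<open>0 \<le> \<parallel>f - g / M\<parallel>\<^sup>2\<close> for \<open>g = (\<Sum>s. a s \<phi> s)\<close>; the mixed term is \<open>- 2 B / M\<close> and the last one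
  at most \<open>B / M\<close>, where \<open>B\<close> is the sum of squares.\<close>

lemma almost_orthogonal_bessel:
  fixes \<phi> :: "'s \<Rightarrow> real^'n \<Rightarrow> complex"
  assumes F: "finite F" and f: "square_integrable f"
    and \<phi>: "\<And>s. s \<in> F \<Longrightarrow> square_integrable (\<phi> s)"
    and M: "0 < M"
    and gram: "(\<Sum>s\<in>F. \<Sum>t\<in>F. cmod (l2_inner f (\<phi> s)) * cmod (l2_inner f (\<phi> t))
        * cmod (l2_inner (\<phi> s) (\<phi> t))) \<le> M * (\<Sum>s\<in>F. (cmod (l2_inner f (\<phi> s)))\<^sup>2)"
  shows "(\<Sum>s\<in>F. (cmod (l2_inner f (\<phi> s)))\<^sup>2) \<le> M * (l2_norm f)\<^sup>2"
proof -
  define a where "a = (\<lambda>s. l2_inner f (\<phi> s))"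
  define B where "B = (\<Sum>s\<in>F. (cmod (a s))\<^sup>2)"
  define g where "g = (\<lambda>x. \<Sum>s\<in>F. a s * \<phi> s x)"
  define L where "L = (\<lambda>x. \<Sum>s\<in>F. cnj (a s) * (f x * cnj (\<phi> s x)))"
  define H where "H = (\<lambda>x. \<Sum>s\<in>F. \<Sum>t\<in>F. (a s * cnj (a t)) * (\<phi> s x * cnj (\<phi> t x)))"
  have L: "L x = f x * cnj (g x)" for x
    by (simp add: L_def g_def sum_distrib_left mult_ac)
  have H: "H x = g x * cnj (g x)" for x
    by (simp add: H_def g_def sum_product mult_ac)
  have int_L: "integrable lebesgue L"
    unfolding L_def by (intro Bochner_Integration.integrable_sum integrable_mult_right
        square_integrable_mult f \<phi>)
  have int_H: "integrable lebesgue H"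
    unfolding H_def by (intro Bochner_Integration.integrable_sum integrable_mult_right
        square_integrable_mult \<phi>)
  have int_f: "integrable lebesgue (\<lambda>x. (cmod (f x))\<^sup>2)"
    using f by (simp add: square_integrable_def)
  have "integral\<^sup>L lebesgue L = (\<Sum>s\<in>F. cnj (a s) * a s)"
    unfolding L_def a_def l2_inner_def
    by (subst Bochner_Integration.integral_sum)
       (auto intro!: integrable_mult_right square_integrable_mult f \<phi> sum.cong)
  also have "\<dots> = complex_of_real B"
    by (simp add: B_def complex_norm_square mult.commute del: of_real_power)
  finally have L_val: "integral\<^sup>L lebesgue L = complex_of_real B" .
  have "integral\<^sup>L lebesgue H
      = (\<Sum>s\<in>F. (LINT x|lebesgue. (\<Sum>t\<in>F. (a s * cnj (a t)) * (\<phi> s x * cnj (\<phi> t x)))))"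
    unfolding H_def by (intro Bochner_Integration.integral_sum Bochner_Integration.integrable_sum
        integrable_mult_right square_integrable_mult \<phi>)
  also have "\<dots> = (\<Sum>s\<in>F. \<Sum>t\<in>F. (LINT x|lebesgue. (a s * cnj (a t)) * (\<phi> s x * cnj (\<phi> t x))))"
    by (intro sum.cong refl Bochner_Integration.integral_sum integrable_mult_right
        square_integrable_mult \<phi>)
  also have "\<dots> = (\<Sum>s\<in>F. \<Sum>t\<in>F. (a s * cnj (a t)) * l2_inner (\<phi> s) (\<phi> t))"
    by (simp only: l2_inner_def integral_mult_right_zero)
  finally have "integral\<^sup>L lebesgue H
      = (\<Sum>s\<in>F. \<Sum>t\<in>F. (a s * cnj (a t)) * l2_inner (\<phi> s) (\<phi> t))" .
  then have "Re (integral\<^sup>L lebesgue H)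
      \<le> (\<Sum>s\<in>F. \<Sum>t\<in>F. cmod ((a s * cnj (a t)) * l2_inner (\<phi> s) (\<phi> t)))"
    by (simp only:) (intro order_trans[OF complex_Re_le_cmod] order_trans[OF norm_sum] sum_mono norm_sum)
  also have "\<dots> \<le> M * B"
    using gram by (simp add: a_def B_def norm_mult)
  finally have H_val: "Re (integral\<^sup>L lebesgue H) \<le> M * B" .
  have expand: "(cmod (f x - complex_of_real (1 / M) * g x))\<^sup>2
      = (cmod (f x))\<^sup>2 - (2 / M) * Re (L x) + (1 / M)\<^sup>2 * Re (H x)" for x
    unfolding L H cmod_power2 by (simp add: power2_eq_square algebra_simps add_divide_distrib)
  have "0 \<le> (LINT x|lebesgue. (cmod (f x - complex_of_real (1 / M) * g x))\<^sup>2)"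
    by (intro Bochner_Integration.integral_nonneg) simp
  also have "\<dots> = (LINT x|lebesgue. (cmod (f x))\<^sup>2 - (2 / M) * Re (L x) + (1 / M)\<^sup>2 * Re (H x))"
    by (simp only: expand)
  also have "\<dots> = (l2_norm f)\<^sup>2 - (2 / M) * Re (integral\<^sup>L lebesgue L)
      + (1 / M)\<^sup>2 * Re (integral\<^sup>L lebesgue H)"
    using int_f int_L int_H by (simp add: l2_norm_squared)
  also have "\<dots> \<le> (l2_norm f)\<^sup>2 - (2 / M) * B + (1 / M)\<^sup>2 * (M * B)"
    using H_val by (intro add_mono mult_left_mono) (auto simp: L_val)
  also have "\<dots> = (l2_norm f)\<^sup>2 - B / M"
    using M by (simp add: power2_eq_square)
  finally have "B / M \<le> (l2_norm f)\<^sup>2"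
    by simp
  then show ?thesis
    using M by (simp add: B_def a_def pos_divide_le_eq mult.commute)
qed


section \<open>Clusters of tiles\<close>

lemma infsum_mono_subset_ennreal:
  fixes f :: "'a \<Rightarrow> ennreal"
  assumes "A \<subseteq> B"
  shows "infsum f A \<le> infsum f B"
  by (rule infsum_mono_neutral) (use assms in \<open>auto intro: nonneg_summable_on_complete\<close>)

lemma cluster_disjoint:
  "cluster C0 C1 A \<phi> I \<Longrightarrow> s \<in> A \<Longrightarrow> t \<in> A \<Longrightarrow> s \<noteq> t \<Longrightarrow> tile_set s \<inter> tile_set t = {}"
  by (simp add: cluster_def)

lemma cluster_orthogonal:
  "cluster C0 C1 A \<phi> I \<Longrightarrow> s \<in> A \<Longrightarrow> t \<in> A \<Longrightarrow> s \<noteq> t \<Longrightarrow> \<Omega>_of s \<inter> \<Omega>_of t \<noteq> {} \<Longrightarrow>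
    l2_inner (\<phi> s) (\<phi> t) = 0"
  by (simp add: cluster_def)

lemma cluster_subset_shadow: "cluster C0 C1 A \<phi> I \<Longrightarrow> s \<in> A \<Longrightarrow> W_of s \<subseteq> I"
  by (simp add: cluster_def)

text \<open>The hypotheses of the estimate that do not involve the function \<open>f\<close>. They are collected in a locale
  because they are verified again for subcollections and for encoded frequency sets.\<close>

locale separated_clusters =
  fixes S :: "('n::finite, 'b) tile set" and \<I> :: "(real^'n) set set"
    and C :: "(real^'n) set \<Rightarrow> ('n, 'b) tile set"
    and \<phi> :: "('n, 'b) tile \<Rightarrow> real^'n \<Rightarrow> complex" and C0 C1 :: real
  assumes tiles: "s \<in> S \<Longrightarrow> is_tile s"
    and S_eq: "S = (\<Union>I\<in>\<I>. C I)"
    and disjoint: "disjoint_family_on C \<I>"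
    and adapted: "adapted C0 S \<phi>"
    and C1: "0 \<le> C1"
    and clusters: "I \<in> \<I> \<Longrightarrow> cluster C0 C1 (C I) \<phi> I"
    and grid: "grid (\<Omega>_of ` S)"
    and nested: "s \<in> S \<Longrightarrow> s' \<in> S \<Longrightarrow> \<Omega>_of s \<subseteq> \<Omega>_of s' \<Longrightarrow> centered (W_of s') \<subseteq> centered (W_of s)"
    and separated: "s \<in> S \<Longrightarrow> s' \<in> S \<Longrightarrow> I \<in> \<I> \<Longrightarrow> s \<noteq> s' \<Longrightarrow> s \<in> C I \<Longrightarrow> \<Omega>_of s \<subseteq> \<Omega>_of s' \<Longrightarrow>
      s' \<in> C I \<or> W_of s' \<inter> I = {}"
begin

lemma \<phi>_norm: "s \<in> S \<Longrightarrow> l2_norm (\<phi> s) = 1"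
  using adapted by (simp add: adapted_def)

lemma \<phi>_decay:
  "s \<in> S \<Longrightarrow> cmod (\<phi> s x) \<le>
    C0 / sqrt (measure lebesgue (W_of s)) / (1 + \<sigma> x (W_of s)) ^ (2 * CARD('n) + 5)"
  using adapted by (simp add: adapted_def)

text \<open>Square integrability is read off from the norm being 1, because the integral of a function that
  is not integrable is 0 by convention.\<close>

lemma \<phi>_square_integrable:
  assumes "s \<in> S"
  shows "square_integrable (\<phi> s)"
proof -
  have "schwartz (\<phi> s)"
    using assms adapted by (simp add: adapted_def)
  then have "\<phi> s differentiable (at x)" for x
    unfolding schwartz_def by (metis foldr_Nil id_apply)
  then have "continuous_on UNIV (\<phi> s)"
    by (simp add: continuous_on_eq_continuous_at differentiable_imp_continuous_within)
  then have "\<phi> s \<in> borel_measurable lebesgue"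
    by (intro measurable_completion) (simp add: borel_measurable_continuous_onI)
  moreover have "integrable lebesgue (\<lambda>x. (cmod (\<phi> s x))\<^sup>2)"
    using \<phi>_norm[OF assms] not_integrable_integral_eq by (fastforce simp: l2_norm_def)
  ultimately show ?thesis
    by (simp add: square_integrable_def)
qed

lemma \<Omega>_nonempty:
  assumes "s \<in> S"
  shows "\<Omega>_of s \<noteq> {}"
proof
  assume "\<Omega>_of s = {}"
  then have "l2_inner (\<phi> s) (\<phi> s) = 0"
    using assms adapted by (simp add: adapted_def)
  then show False
    using \<phi>_norm[OF assms] by (simp add: l2_inner_self)
qed

definition shadow :: "('n, 'b) tile \<Rightarrow> (real^'n) set" where
  "shadow s = (THE I. I \<in> \<I> \<and> s \<in> C I)"

lemma shadow_eq: "I \<in> \<I> \<Longrightarrow> s \<in> C I \<Longrightarrow> shadow s = I"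
  unfolding shadow_def using disjoint by (intro the_equality) (auto simp: disjoint_family_on_def)

lemma shadow: "s \<in> S \<Longrightarrow> shadow s \<in> \<I>" "s \<in> S \<Longrightarrow> s \<in> C (shadow s)"
  using S_eq shadow_eq by (metis UN_E)+

lemma W_subset_shadow: "s \<in> S \<Longrightarrow> W_of s \<subseteq> shadow s"
  by (rule cluster_subset_shadow[OF clusters[OF shadow(1)] shadow(2)])

text \<open>Tiles whose functions can correlate with that of \<open>s\<close>: their frequency sets contain that of \<open>s\<close>,
  which makes their spatial sets the smaller ones, and they lie in other clusters.\<close>

definition above :: "('n, 'b) tile \<Rightarrow> ('n, 'b) tile set" where
  "above s = {t \<in> S. \<Omega>_of s \<subseteq> \<Omega>_of t \<and> shadow t \<noteq> shadow s}"

lemma correlated_above: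
  assumes s: "s \<in> S" and t: "t \<in> S" and "s \<noteq> t" and inner: "l2_inner (\<phi> s) (\<phi> t) \<noteq> 0"
  shows "t \<in> above s \<or> s \<in> above t"
proof -
  have meet: "\<Omega>_of s \<inter> \<Omega>_of t \<noteq> {}"
    using adapted s t inner by (auto simp: adapted_def)
  then have "\<Omega>_of s \<subseteq> \<Omega>_of t \<or> \<Omega>_of t \<subseteq> \<Omega>_of s"
    using grid s t unfolding grid_def by blast
  moreover have "shadow s \<noteq> shadow t"
    using cluster_orthogonal[OF clusters[OF shadow(1)[OF s]] shadow(2)[OF s] _ \<open>s \<noteq> t\<close> meet]
      shadow(2)[OF t] inner by metis
  ultimately show ?thesis
    using s t by (auto simp: above_def)
qed

lemma W_outside_shadow:
  assumes "s \<in> S" "t \<in> above s"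
  shows "W_of t \<inter> shadow s = {}"
proof -
  have "t \<in> S" "\<Omega>_of s \<subseteq> \<Omega>_of t" "t \<notin> C (shadow s)" "s \<noteq> t"
    using assms(2) shadow_eq[OF shadow(1)[OF assms(1)], of t] unfolding above_def by blast+
  then show ?thesis
    using separated[of s t "shadow s"] assms(1) shadow by blast
qed

text \<open>The frequency sets of two tiles above \<open>s\<close> share the points of that of \<open>s\<close>, so they are nested. If
  the two tiles belong to one cluster, then being disjoint they must have disjoint spatial sets; if not,
  then one spatial set lies in its shadow and the other one avoids that shadow.\<close>

lemma above_disjoint:
  assumes s: "s \<in> S" and t: "t \<in> above s" and t': "t' \<in> above s" and "t \<noteq> t'"
  shows "W_of t \<inter> W_of t' = {}"
proof -
  have S: "t \<in> S" "t' \<in> S" and meet: "\<Omega>_of t \<inter> \<Omega>_of t' \<noteq> {}"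
    using t t' \<Omega>_nonempty[OF s] by (auto simp: above_def)
  show ?thesis
  proof (cases "shadow t = shadow t'")
    case True
    then have "tile_set t \<inter> tile_set t' = {}"
      using cluster_disjoint[OF clusters[OF shadow(1)] shadow(2) _ \<open>t \<noteq> t'\<close>] shadow(2) S by metis
    then show ?thesis
      using meet by (auto simp: tile_set_def)
  next
    case False
    have "\<Omega>_of t \<subseteq> \<Omega>_of t' \<or> \<Omega>_of t' \<subseteq> \<Omega>_of t"
      using grid S meet unfolding grid_def by blast
    then have "t' \<in> above t \<or> t \<in> above t'"
      using S False by (auto simp: above_def)
    then show ?thesis
      using W_outside_shadow W_subset_shadow S by blast
  qed
qed

text \<open>A lower bound for \<open>(1 + \<sigma> x (W_of s)) ^ - (d + 1)\<close> that is constant on the spatial set of \<open>t\<close>; having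
  a constant there avoids measurability questions about \<open>\<sigma>\<close>.\<close>

definition weight :: "('n, 'b) tile \<Rightarrow> ('n, 'b) tile \<Rightarrow> real" where
  "weight s t = 1 / (2 * (1 + \<sigma> (center_of_mass (W_of t)) (W_of s))) ^ (CARD('n) + 1)"

definition tail :: "('n, 'b) tile set \<Rightarrow> ('n, 'b) tile \<Rightarrow> real" where
  "tail F s = (\<Sum>t\<in>F \<inter> above s. weight s t * measure lebesgue (W_of t))"

lemma weight_nonneg: "s \<in> S \<Longrightarrow> 0 \<le> weight s t"
  using \<sigma>_nonneg[OF tiles] by (simp add: weight_def)

lemma tail_nonneg: "s \<in> S \<Longrightarrow> 0 \<le> tail F s"
  unfolding tail_def by (intro sum_nonneg mult_nonneg_nonneg weight_nonneg) auto

lemma weight_le: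
  assumes s: "s \<in> S" and t: "t \<in> above s" and x: "x \<in> W_of t"
  shows "weight s t \<le> 1 / (1 + \<sigma> x (W_of s)) ^ (CARD('n) + 1)"
proof -
  let ?c = "center_of_mass (W_of t)"
  have t': "t \<in> S" "\<Omega>_of s \<subseteq> \<Omega>_of t"
    using t by (auto simp: above_def)
  have "\<sigma> x (W_of s) \<le> \<sigma> ?c (W_of s) + \<sigma> ?c (W_of t) + \<sigma> x (W_of t)"
    using s t' by (intro \<sigma>_triangle tiles nested)
  then have "1 + \<sigma> x (W_of s) \<le> 2 * (1 + \<sigma> ?c (W_of s))"
    using \<sigma>_center[OF tiles[OF t'(1)]] \<sigma>_le_1[OF x] \<sigma>_nonneg[OF tiles[OF s], of ?c] by simp
  then show ?thesis
    unfolding weight_def using \<sigma>_nonneg[OF tiles[OF s]]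
    by (intro divide_left_mono power_mono mult_pos_pos zero_less_power) (auto simp: add_pos_nonneg)
qed

text \<open>The spatial sets of the tiles above \<open>s\<close> are disjoint and avoid the shadow of \<open>s\<close>, so the tail is a
  lower sum for the integral that the cluster condition controls.\<close>

lemma tail_le_nn_integral:
  assumes F: "finite F" and s: "s \<in> S"
  shows "ennreal (tail F s)
    \<le> (\<integral>\<^sup>+x\<in>- shadow s. ennreal (1 / (1 + \<sigma> x (W_of s)) ^ (CARD('n) + 1)) \<partial>lebesgue)"
proof -
  let ?U = "F \<inter> above s"
  let ?g = "\<lambda>x. ennreal (1 / (1 + \<sigma> x (W_of s)) ^ (CARD('n) + 1)) * indicator (- shadow s) x"
  have U: "finite ?U" "\<And>t. t \<in> ?U \<Longrightarrow> W_of t \<in> lmeasurable"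
    using F tiles by (auto simp: above_def is_tile_def)
  have "ennreal (tail F s) = (\<Sum>t\<in>?U. ennreal (weight s t) * emeasure lebesgue (W_of t))"
    using U(2) weight_nonneg[OF s]
    by (subst tail_def, subst sum_ennreal[symmetric])
       (auto simp: emeasure_eq_measure2 ennreal_mult intro!: sum.cong)
  also have "\<dots> = (\<integral>\<^sup>+x. (\<Sum>t\<in>?U. ennreal (weight s t) * indicator (W_of t) x) \<partial>lebesgue)"
    using U by (subst nn_integral_sum) (auto simp: nn_integral_cmult_indicator fmeasurableD intro!: sum.cong)
  also have "\<dots> \<le> (\<integral>\<^sup>+x. ?g x \<partial>lebesgue)"
  proof (rule nn_integral_mono)
    fix x
    show "(\<Sum>t\<in>?U. ennreal (weight s t) * indicator (W_of t) x) \<le> ?g x"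
    proof (cases "\<exists>t\<in>?U. x \<in> W_of t")
      case True
      then obtain t where t: "t \<in> ?U" "x \<in> W_of t" by blast
      then have "x \<notin> W_of t'" if "t' \<in> ?U - {t}" for t'
        using above_disjoint[OF s, of t t'] that by blast
      then have "(\<Sum>t\<in>?U. ennreal (weight s t) * indicator (W_of t) x) = ennreal (weight s t)"
        using t U(1) by (subst sum.remove[of _ t]) auto
      also have "\<dots> \<le> ?g x"
        using weight_le[OF s _ t(2)] W_outside_shadow[OF s, of t] t
        by (auto intro!: ennreal_leI simp: indicator_def simp del: power_Suc)
      finally show ?thesis .
    qed (auto intro!: order_trans[OF eq_refl[OF sum.neutral]])
  qed
  finally show ?thesis .
qed

lemma sum_tail_squared_le:
  assumes F: "finite F" and I: "I \<in> \<I>" and A: "finite A" "A \<subseteq> C I"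
  shows "(\<Sum>s\<in>A. (tail F s)\<^sup>2 / measure lebesgue (W_of s)) \<le> C1 * measure lebesgue I"
proof -
  have A': "s \<in> S" "shadow s = I" "0 < measure lebesgue (W_of s)" if "s \<in> A" for s
  proof -
    have "s \<in> C I" using that A(2) by blast
    then show "s \<in> S" "shadow s = I"
      using I S_eq shadow_eq by blast+
    then show "0 < measure lebesgue (W_of s)"
      using tiles by (simp add: is_tile_def)
  qed
  let ?g = "\<lambda>s. (\<integral>\<^sup>+x\<in>- I. ennreal (1 / (1 + \<sigma> x (W_of s)) ^ (CARD('n) + 1)) \<partial>lebesgue)\<^sup>2
               / ennreal (measure lebesgue (W_of s))"
  have "ennreal (\<Sum>s\<in>A. (tail F s)\<^sup>2 / measure lebesgue (W_of s))
      = (\<Sum>s\<in>A. (ennreal (tail F s))\<^sup>2 / ennreal (measure lebesgue (W_of s)))"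
    using A' tail_nonneg by (subst sum_ennreal[symmetric]) (auto simp: divide_ennreal ennreal_power intro!: sum.cong)
  also have "\<dots> \<le> sum ?g A"
  proof (intro sum_mono divide_right_mono_ennreal power_mono)
    show "ennreal (tail F s)
        \<le> (\<integral>\<^sup>+x\<in>- I. ennreal (1 / (1 + \<sigma> x (W_of s)) ^ (CARD('n) + 1)) \<partial>lebesgue)" if "s \<in> A" for s
      using tail_le_nn_integral[OF F A'(1)[OF that]] unfolding A'(2)[OF that] .
  qed simp
  also have "sum ?g A \<le> (\<Sum>\<^sub>\<infinity>s\<in>C I. ?g s)"
    unfolding infsum_finite[OF A(1), symmetric] by (rule infsum_mono_subset_ennreal[OF A(2)])
  also have "\<dots> \<le> ennreal (C1 * measure lebesgue I)"
    using clusters[OF I] by (simp add: cluster_def)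
  finally show ?thesis
    using C1 by (subst (asm) ennreal_le_iff) auto
qed

text \<open>The size assumption on the coefficient and the correlation estimate each contribute a factor
  \<open>sqrt |W t|\<close>, which together make the measure of \<open>W t\<close>.\<close>

lemma row_sum_le:
  assumes s: "s \<in> S" and lam: "0 \<le> lam"
    and coeff: "\<And>t. t \<in> S \<Longrightarrow> a t \<le> 2 * lam * sqrt (measure lebesgue (W_of t))"
  shows "(\<Sum>t\<in>F \<inter> above s. a t * cmod (l2_inner (\<phi> s) (\<phi> t)))
    \<le> 2 * lam * (zeta2 * 2 ^ (CARD('n) + 1)) * C0\<^sup>2 * (tail F s / sqrt (measure lebesgue (W_of s)))"
proof -
  let ?m = "\<lambda>t. measure lebesgue (W_of t)"
  let ?k = "2 * lam * (zeta2 * 2 ^ (CARD('n) + 1)) * C0\<^sup>2"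
  have "a t * cmod (l2_inner (\<phi> s) (\<phi> t)) \<le> ?k * (weight s t * ?m t / sqrt (?m s))"
    if t: "t \<in> F \<inter> above s" for t
  proof -
    have t': "t \<in> S" "\<Omega>_of s \<subseteq> \<Omega>_of t"
      using t by (auto simp: above_def)
    define D where "D = (1 + \<sigma> (center_of_mass (W_of t)) (W_of s)) ^ (CARD('n) + 1)"
    have w: "weight s t = 1 / (2 ^ (CARD('n) + 1) * D)"
      unfolding weight_def D_def by (simp only: power_mult_distrib)
    have sq: "sqrt (?m t) * sqrt (?m t) = ?m t"
      by simp
    have "a t * cmod (l2_inner (\<phi> s) (\<phi> t))
        \<le> (2 * lam * sqrt (?m t)) * (zeta2 * C0\<^sup>2 * sqrt (?m t) / sqrt (?m s) / D)"
      unfolding D_def using lam s t' by (intro mult_mono coeff l2_inner_decay tiles nested \<phi>_decay) auto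
    also have "\<dots> = 2 * lam * zeta2 * C0\<^sup>2 * (sqrt (?m t) * sqrt (?m t)) / sqrt (?m s) / D"
      by (simp only: times_divide_eq_right mult_ac)
    also have "\<dots> = ?k * (weight s t * ?m t / sqrt (?m s))"
      unfolding w sq by (simp del: power_Suc add: mult_ac)
    finally show ?thesis .
  qed
  then have "(\<Sum>t\<in>F \<inter> above s. a t * cmod (l2_inner (\<phi> s) (\<phi> t)))
      \<le> (\<Sum>t\<in>F \<inter> above s. ?k * (weight s t * ?m t / sqrt (?m s)))"
    by (rule sum_mono)
  also have "\<dots> = ?k * (tail F s / sqrt (?m s))"
    by (simp only: tail_def sum_distrib_left sum_divide_distrib)
  finally show ?thesis .
qed

end


section \<open>The estimate\<close>

context separated_clusters
begin

lemma sum_over_clusters: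
  assumes G: "finite G" "G \<subseteq> \<I>"
    and A: "\<And>I. I \<in> G \<Longrightarrow> finite (A I)" "\<And>I. I \<in> G \<Longrightarrow> A I \<subseteq> C I"
  shows "sum h (\<Union>I\<in>G. A I) = (\<Sum>I\<in>G. sum h (A I))"
proof (rule sum.UNION_disjoint)
  show "\<forall>I\<in>G. \<forall>J\<in>G. I \<noteq> J \<longrightarrow> A I \<inter> A J = {}"
    using disjoint G(2) A(2) unfolding disjoint_family_on_def by blast
qed (use G A in simp_all)

text \<open>Off the diagonal each nonzero entry of the Gram matrix pairs a tile with one above it. The rows are
  bounded by tails, and Cauchy-Schwarz combines the square sum \<open>B\<close> of the coefficients with the square
  sum of the tails, which the cluster condition bounds by \<open>C1\<close> times the total volume of the shadows.
  The energy hypothesis bounds \<open>lam\<^sup>2\<close> times that volume by \<open>2 * B\<close>, so that everything is a multiple of \<open>B\<close>.\<close>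

lemma gram_le:
  assumes G: "finite G" "G \<subseteq> \<I>"
    and A: "\<And>I. I \<in> G \<Longrightarrow> finite (A I)" "\<And>I. I \<in> G \<Longrightarrow> A I \<subseteq> C I"
    and lam: "0 < lam"
    and a_nonneg: "\<And>s. 0 \<le> a s"
    and coeff: "\<And>s. s \<in> S \<Longrightarrow> a s \<le> 2 * lam * sqrt (measure lebesgue (W_of s))"
    and energy: "lam\<^sup>2 * (\<Sum>I\<in>G. measure lebesgue I) \<le> 2 * (\<Sum>s\<in>(\<Union>I\<in>G. A I). (a s)\<^sup>2)"
  shows "(\<Sum>s\<in>(\<Union>I\<in>G. A I). \<Sum>t\<in>(\<Union>I\<in>G. A I). a s * a t * cmod (l2_inner (\<phi> s) (\<phi> t)))
    \<le> (1 + 8 * (zeta2 * 2 ^ (CARD('n) + 1)) * (sqrt C1 * C0\<^sup>2)) * (\<Sum>s\<in>(\<Union>I\<in>G. A I). (a s)\<^sup>2)"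
proof -
  define F where "F = (\<Union>I\<in>G. A I)"
  define \<kappa> where "\<kappa> = zeta2 * 2 ^ (CARD('n) + 1)"
  define B where "B = (\<Sum>s\<in>F. (a s)\<^sup>2)"
  define N where "N = (\<Sum>I\<in>G. measure lebesgue I)"
  define c where "c = (\<lambda>s t. cmod (l2_inner (\<phi> s) (\<phi> t)))"
  define b where "b = (\<lambda>s. tail F s / sqrt (measure lebesgue (W_of s)))"
  define T where "T = (\<Sum>s\<in>F. \<Sum>t\<in>F \<inter> above s. a s * a t * c s t)"
  define X where "X = (\<Sum>s\<in>F. a s * b s)"
  have F: "finite F" "F \<subseteq> S"
    unfolding F_def S_eq using G A by (blast intro: finite_UN_I)+
  have B: "0 \<le> B"
    by (simp add: B_def sum_nonneg)
  have \<kappa>: "0 \<le> \<kappa>"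
    using zeta2_ge_1 by (simp add: \<kappa>_def)
  have b2: "(b s)\<^sup>2 = (tail F s)\<^sup>2 / measure lebesgue (W_of s)" for s
    by (simp add: b_def power_divide)
  have c_sym: "c s t = c t s" for s t
    by (metis c_def complex_mod_cnj l2_inner_commute)
  have entry: "a s * a t * c s t \<le> (if s = t then (a s)\<^sup>2 else 0)
      + (if t \<in> above s then a s * a t * c s t else 0)
      + (if s \<in> above t then a s * a t * c s t else 0)" if "s \<in> F" "t \<in> F" for s t
  proof (cases "s = t")
    case True
    moreover have "c t t = 1"
      using \<phi>_norm[OF subsetD[OF F(2) \<open>t \<in> F\<close>]] by (simp add: c_def l2_inner_self)
    ultimately show ?thesis
      by (simp add: power2_eq_square above_def)
  next
    case False
    have "0 \<le> a s * a t * c s t"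
      using a_nonneg by (simp add: c_def)
    moreover have "c s t = 0" if "t \<notin> above s" "s \<notin> above t"
      using correlated_above[of s t] that False F \<open>s \<in> F\<close> \<open>t \<in> F\<close> by (auto simp: c_def)
    ultimately show ?thesis
      using False by auto
  qed
  have "(\<Sum>s\<in>F. \<Sum>t\<in>F. a s * a t * c s t) \<le> (\<Sum>s\<in>F. \<Sum>t\<in>F. (if s = t then (a s)\<^sup>2 else 0)
      + (if t \<in> above s then a s * a t * c s t else 0)
      + (if s \<in> above t then a s * a t * c s t else 0))"
    by (intro sum_mono entry)
  also have "\<dots> = B + T + (\<Sum>s\<in>F. \<Sum>t\<in>F. if s \<in> above t then a s * a t * c s t else 0)"
    using F(1) by (simp add: sum.distrib B_def T_def sum.inter_restrict)
  also have "(\<Sum>s\<in>F. \<Sum>t\<in>F. if s \<in> above t then a s * a t * c s t else 0) = T"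
    unfolding T_def
    by (subst sum.swap) (simp add: sum.inter_restrict[OF F(1)] c_sym mult.commute mult.left_commute cong: if_cong)
  finally have gram: "(\<Sum>s\<in>F. \<Sum>t\<in>F. a s * a t * c s t) \<le> B + 2 * T"
    by simp
  have "T = (\<Sum>s\<in>F. a s * (\<Sum>t\<in>F \<inter> above s. a t * c s t))"
    by (simp add: T_def sum_distrib_left mult.assoc)
  also have "\<dots> \<le> (\<Sum>s\<in>F. a s * (2 * lam * \<kappa> * C0\<^sup>2 * b s))"
    unfolding c_def b_def \<kappa>_def using F lam
    by (intro sum_mono mult_left_mono row_sum_le a_nonneg coeff) auto
  also have "\<dots> = 2 * \<kappa> * C0\<^sup>2 * (lam * X)"
    by (simp add: X_def sum_distrib_left mult_ac)
  finally have T: "T \<le> 2 * \<kappa> * C0\<^sup>2 * (lam * X)" .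
  have "(\<Sum>s\<in>F. (b s)\<^sup>2) = (\<Sum>I\<in>G. \<Sum>s\<in>A I. (b s)\<^sup>2)"
    unfolding F_def by (rule sum_over_clusters[OF G A])
  also have "\<dots> \<le> (\<Sum>I\<in>G. C1 * measure lebesgue I)"
    unfolding b2 using G A by (intro sum_mono sum_tail_squared_le F(1)) auto
  finally have tails: "(\<Sum>s\<in>F. (b s)\<^sup>2) \<le> C1 * N"
    by (simp add: N_def sum_distrib_left)
  have "X\<^sup>2 \<le> B * (\<Sum>s\<in>F. (b s)\<^sup>2)"
    unfolding X_def B_def by (rule Cauchy_Schwarz_ineq_sum)
  also have "\<dots> \<le> B * (C1 * N)"
    using tails B by (rule mult_left_mono)
  finally have "lam\<^sup>2 * X\<^sup>2 \<le> lam\<^sup>2 * (B * (C1 * N))"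
    by (rule mult_left_mono) simp
  also have "\<dots> = (B * C1) * (lam\<^sup>2 * N)"
    by (simp only: mult_ac)
  also have "\<dots> \<le> (B * C1) * (2 * B)"
    using energy mult_nonneg_nonneg[OF B C1] unfolding N_def B_def F_def by (rule mult_left_mono)
  also have "\<dots> \<le> 4 * (C1 * B\<^sup>2)"
    using mult_nonneg_nonneg[OF C1 zero_le_power2[of B]] by (simp add: power2_eq_square mult_ac)
  also have "\<dots> = (2 * sqrt C1 * B)\<^sup>2"
    using C1 by (simp add: power_mult_distrib)
  finally have "(lam * X)\<^sup>2 \<le> (2 * sqrt C1 * B)\<^sup>2"
    by (simp only: power_mult_distrib)
  then have "lam * X \<le> 2 * sqrt C1 * B"
    by (rule power2_le_imp_le) (use B C1 in simp)
  then have "2 * \<kappa> * C0\<^sup>2 * (lam * X) \<le> 2 * \<kappa> * C0\<^sup>2 * (2 * sqrt C1 * B)"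
    using \<kappa> by (intro mult_left_mono) auto
  with T have "B + 2 * T \<le> B + 2 * (2 * \<kappa> * C0\<^sup>2 * (2 * sqrt C1 * B))"
    by linarith
  also have "\<dots> = (1 + 8 * \<kappa> * (sqrt C1 * C0\<^sup>2)) * B"
    by (simp add: algebra_simps)
  finally have "(\<Sum>s\<in>F. \<Sum>t\<in>F. a s * a t * c s t) \<le> (1 + 8 * \<kappa> * (sqrt C1 * C0\<^sup>2)) * B"
    using gram by linarith
  then show ?thesis
    unfolding F_def \<kappa>_def B_def c_def .
qed

text \<open>Half of the square sum of a cluster is carried by finitely many tiles, so that all further sums are
  finite.\<close>

lemma finite_energy:
  assumes I: "I \<in> \<I>" and lam: "0 < lam" and SQ: "lam \<le> SQ (C I) \<phi> I f"
  shows "\<exists>A. finite A \<and> A \<subseteq> C I \<and>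
    lam\<^sup>2 * measure lebesgue I \<le> 2 * (\<Sum>s\<in>A. (cmod (l2_inner f (\<phi> s)))\<^sup>2)"
proof -
  let ?a = "\<lambda>s. (cmod (l2_inner f (\<phi> s)))\<^sup>2"
  define E where "E = infsum ?a (C I)"
  have I_pos: "0 < measure lebesgue I"
    using clusters[OF I] by (simp add: cluster_def)
  have "lam\<^sup>2 \<le> (SQ (C I) \<phi> I f)\<^sup>2"
    using SQ lam by (intro power_mono) auto
  also have "\<dots> = E / measure lebesgue I"
    by (simp add: SQ_def E_def infsum_nonneg)
  finally have E: "lam\<^sup>2 * measure lebesgue I \<le> E"
    using I_pos by (simp add: pos_le_divide_eq)
  moreover have "0 < lam\<^sup>2 * measure lebesgue I"
    using lam I_pos by simp
  ultimately have "0 < E"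
    by linarith
  \<comment> \<open>A divergent sum would have the value 0.\<close>
  then have "?a summable_on C I"
    using infsum_not_exists by (fastforce simp: E_def)
  then obtain A where A: "finite A" "A \<subseteq> C I" "dist (sum ?a A) E \<le> E / 2"
    using infsum_finite_approximation[of ?a "C I" "E / 2"] \<open>0 < E\<close> by (auto simp: E_def)
  then have "E \<le> 2 * sum ?a A"
    unfolding dist_real_def by linarith
  with A E show ?thesis
    by (intro exI[of _ A]) auto
qed

text \<open>The volume of the shadows and the square sum of the coefficients bound each other: the first is
  bounded by the second through \<open>finite_energy\<close>, and this bound enters the Gram estimate, which through
  Bessel's inequality bounds the second by \<open>\<parallel>f\<parallel>\<^sup>2\<close>.\<close>

lemma sum_shadows_le:
  assumes f: "square_integrable f" and lam: "0 < lam"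
    and SQ: "\<And>I. I \<in> \<I> \<Longrightarrow> lam \<le> SQ (C I) \<phi> I f"
    and coeff: "\<And>s. s \<in> S \<Longrightarrow>
      cmod (l2_inner f (\<phi> s)) \<le> 2 * lam * sqrt (measure lebesgue (W_of s))"
    and G: "finite G" "G \<subseteq> \<I>"
  shows "(\<Sum>I\<in>G. measure lebesgue I)
    \<le> 1 / lam\<^sup>2 * (16 * (zeta2 * 2 ^ (CARD('n) + 1))) * (1 + sqrt C1 * C0\<^sup>2) * (l2_norm f)\<^sup>2"
proof -
  let ?a = "\<lambda>s. cmod (l2_inner f (\<phi> s))"
  define \<kappa> where "\<kappa> = zeta2 * 2 ^ (CARD('n) + 1)"
  define M where "M = 1 + 8 * \<kappa> * (sqrt C1 * C0\<^sup>2)"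
  define N where "N = (\<Sum>I\<in>G. measure lebesgue I)"
  have "\<forall>I\<in>G. \<exists>A. finite A \<and> A \<subseteq> C I \<and> lam\<^sup>2 * measure lebesgue I \<le> 2 * (\<Sum>s\<in>A. (?a s)\<^sup>2)"
    using finite_energy[OF _ lam SQ] G(2) by blast
  then obtain A where A: "\<And>I. I \<in> G \<Longrightarrow> finite (A I)" "\<And>I. I \<in> G \<Longrightarrow> A I \<subseteq> C I"
    and A_energy: "\<And>I. I \<in> G \<Longrightarrow> lam\<^sup>2 * measure lebesgue I \<le> 2 * (\<Sum>s\<in>A I. (?a s)\<^sup>2)"
    by metis
  define F where "F = (\<Union>I\<in>G. A I)"
  have F: "finite F" "F \<subseteq> S"
    unfolding F_def S_eq using G A by (blast intro: finite_UN_I)+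
  have "lam\<^sup>2 * N \<le> (\<Sum>I\<in>G. 2 * (\<Sum>s\<in>A I. (?a s)\<^sup>2))"
    unfolding N_def sum_distrib_left[of "lam\<^sup>2"] by (rule sum_mono[OF A_energy])
  also have "\<dots> = 2 * (\<Sum>s\<in>F. (?a s)\<^sup>2)"
    unfolding F_def by (simp only: sum_over_clusters[OF G A] sum_distrib_left)
  finally have energy: "lam\<^sup>2 * N \<le> 2 * (\<Sum>s\<in>F. (?a s)\<^sup>2)" .
  have "1 * 1 \<le> zeta2 * 2 ^ (CARD('n) + 1)"
    using zeta2_ge_1 by (intro mult_mono one_le_power) auto
  then have \<kappa>: "1 \<le> \<kappa>"
    by (simp add: \<kappa>_def)
  have prod_nonneg: "0 \<le> sqrt C1 * C0\<^sup>2"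
    using C1 by simp
  have M: "0 < M"
    unfolding M_def using \<kappa>
    by (intro add_pos_nonneg[OF zero_less_one] mult_nonneg_nonneg[OF _ prod_nonneg]) simp
  have "(\<Sum>s\<in>F. (?a s)\<^sup>2) \<le> M * (l2_norm f)\<^sup>2"
  proof (rule almost_orthogonal_bessel[OF F(1) f _ M])
    show "square_integrable (\<phi> s)" if "s \<in> F" for s
      using that F \<phi>_square_integrable by blast
    show "(\<Sum>s\<in>F. \<Sum>t\<in>F. ?a s * ?a t * cmod (l2_inner (\<phi> s) (\<phi> t))) \<le> M * (\<Sum>s\<in>F. (?a s)\<^sup>2)"
      unfolding F_def M_def \<kappa>_def
      using energy by (intro gram_le[OF G A lam _ coeff]) (auto simp: N_def F_def)
  qed
  with energy have "lam\<^sup>2 * N \<le> 2 * (M * (l2_norm f)\<^sup>2)"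
    by linarith
  also have "\<dots> \<le> 2 * ((8 * \<kappa> * (1 + sqrt C1 * C0\<^sup>2)) * (l2_norm f)\<^sup>2)"
    using \<kappa> by (intro mult_left_mono mult_right_mono) (auto simp: M_def algebra_simps)
  finally have "N \<le> 2 * ((8 * \<kappa> * (1 + sqrt C1 * C0\<^sup>2)) * (l2_norm f)\<^sup>2) / lam\<^sup>2"
    using lam by (simp add: pos_le_divide_eq mult.commute)
  also have "\<dots> = 1 / lam\<^sup>2 * (16 * \<kappa>) * (1 + sqrt C1 * C0\<^sup>2) * (l2_norm f)\<^sup>2"
    by simp
  finally show ?thesis
    unfolding N_def \<kappa>_def .
qed

end

lemma separated_clusters_iff:
  "separated_clusters S \<I> C \<phi> C0 C1 \<longleftrightarrow>
    (\<forall>s\<in>S. is_tile s) \<and>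
    S = (\<Union>I\<in>\<I>. C I) \<and> disjoint_family_on C \<I> \<and>
    adapted C0 S \<phi> \<and>
    0 \<le> C1 \<and> (\<forall>I\<in>\<I>. cluster C0 C1 (C I) \<phi> I) \<and>
    grid (\<Omega>_of ` S) \<and>
    (\<forall>s\<in>S. \<forall>s'\<in>S. \<Omega>_of s \<subseteq> \<Omega>_of s' \<longrightarrow> centered (W_of s') \<subseteq> centered (W_of s)) \<and>
    (\<forall>s\<in>S. \<forall>s'\<in>S. \<forall>I\<in>\<I>. s \<noteq> s' \<longrightarrow> s \<in> C I \<longrightarrow> \<Omega>_of s \<subseteq> \<Omega>_of s' \<longrightarrow>
       s' \<in> C I \<or> W_of s' \<inter> I = {})"
  unfolding separated_clusters_def by (intro iffI conjI; (elim conjE)?; meson)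

lemma cluster_estimate_iff:
  "cluster_estimate TYPE('n::finite) TYPE('b) K \<longleftrightarrow>
    (\<forall>(S :: ('n, 'b) tile set) \<I> C \<phi> C0 C1 f lam.
      separated_clusters S \<I> C \<phi> C0 C1 \<longrightarrow> square_integrable f \<longrightarrow> 0 < lam \<longrightarrow>
      (\<forall>I\<in>\<I>. lam \<le> SQ (C I) \<phi> I f) \<longrightarrow>
      (\<forall>s\<in>S. cmod (l2_inner f (\<phi> s)) \<le> 2 * lam * sqrt (measure lebesgue (W_of s))) \<longrightarrow>
      (\<Sum>\<^sub>\<infinity>I\<in>\<I>. emeasure lebesgue I)
        \<le> ennreal (1 / lam\<^sup>2 * K * (1 + sqrt C1 * C0\<^sup>2) * (l2_norm f)\<^sup>2))"
  by (simp only: cluster_estimate_def separated_clusters_iff imp_conjL)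

theorem cluster_estimate_holds:
  "cluster_estimate TYPE('n::finite) TYPE('b) (16 * (zeta2 * 2 ^ (CARD('n) + 1)))"
  unfolding cluster_estimate_iff
proof (intro allI impI)
  fix S :: "('n, 'b) tile set" and \<I> C \<phi> C0 C1 f lam
  assume "separated_clusters S \<I> C \<phi> C0 C1"
  then interpret separated_clusters S \<I> C \<phi> C0 C1 .
  assume *: "square_integrable f" "0 < lam" "\<forall>I\<in>\<I>. lam \<le> SQ (C I) \<phi> I f"
    "\<forall>s\<in>S. cmod (l2_inner f (\<phi> s)) \<le> 2 * lam * sqrt (measure lebesgue (W_of s))"
  show "(\<Sum>\<^sub>\<infinity>I\<in>\<I>. emeasure lebesgue I)
    \<le> ennreal (1 / lam\<^sup>2 * (16 * (zeta2 * 2 ^ (CARD('n) + 1))) * (1 + sqrt C1 * C0\<^sup>2) * (l2_norm f)\<^sup>2)"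
  proof (rule infsum_le_finite_sums)
    fix G assume G: "finite G" "G \<subseteq> \<I>"
    have "I \<in> lmeasurable" if "I \<in> G" for I
      using clusters that G by (auto simp: cluster_def)
    then have "(\<Sum>I\<in>G. emeasure lebesgue I) = ennreal (\<Sum>I\<in>G. measure lebesgue I)"
      by (subst sum_ennreal[symmetric]) (auto simp: emeasure_eq_measure2 intro!: sum.cong)
    also have "\<dots> \<le> ennreal (1 / lam\<^sup>2 * (16 * (zeta2 * 2 ^ (CARD('n) + 1)))
        * (1 + sqrt C1 * C0\<^sup>2) * (l2_norm f)\<^sup>2)"
      using * G by (intro ennreal_leI sum_shadows_le) auto
    finally show "(\<Sum>I\<in>G. emeasure lebesgue I) \<le> \<dots>" .
  qed (auto intro: nonneg_summable_on_complete)
qed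

section \<open>Independence of the ambient set of the frequencies\<close>

lemma adapted_subset:
  fixes A B :: "('n::finite, 'b) tile set"
  assumes "adapted C0 A \<phi>" "B \<subseteq> A"
  shows "adapted C0 B \<phi>"
  unfolding adapted_def
proof (rule ballI)
  fix s assume "s \<in> B"
  then have "s \<in> A" using assms(2) by blast
  from bspec[OF assms(1)[unfolded adapted_def] this]
  show "schwartz (\<phi> s) \<and> l2_norm (\<phi> s) = 1 \<and>
    (\<forall>s'\<in>B. \<Omega>_of s \<inter> \<Omega>_of s' = {} \<longrightarrow> l2_inner (\<phi> s) (\<phi> s') = 0) \<and>
    (\<forall>x. cmod (\<phi> s x) \<le>
      C0 / sqrt (measure lebesgue (W_of s)) / (1 + \<sigma> x (W_of s)) ^ (2 * CARD('n) + 5))"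
    using assms(2) by (elim conjE, intro conjI) (assumption | blast)+
qed

lemma cluster_subset:
  fixes A B :: "('n::finite, 'b) tile set"
  assumes "cluster C0 C1 A \<phi> I" and B: "B \<subseteq> A"
  shows "cluster C0 C1 B \<phi> I"
  unfolding cluster_def
proof (intro conjI)
  let ?g = "\<lambda>s. (\<integral>\<^sup>+x\<in>- I. ennreal (1 / (1 + \<sigma> x (W_of s)) ^ (CARD('n) + 1)) \<partial>lebesgue)\<^sup>2
             / ennreal (measure lebesgue (W_of s))"
  note cl = assms(1)[unfolded cluster_def]
  show "adapted C0 B \<phi>"
    using conjunct1[OF cl] B by (rule adapted_subset)
  have "infsum ?g B \<le> infsum ?g A"
    by (rule infsum_mono_subset_ennreal[OF B])
  also have "\<dots> \<le> ennreal (C1 * measure lebesgue I)"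
    using cl by (elim conjE)
  finally show "infsum ?g B \<le> ennreal (C1 * measure lebesgue I)" .
  show "\<forall>s\<in>B. \<forall>s'\<in>B. s \<noteq> s' \<longrightarrow> tile_set s \<inter> tile_set s' = {}"
    using cluster_disjoint[OF assms(1)] B by blast
  show "\<forall>s\<in>B. W_of s \<subseteq> I"
    using cluster_subset_shadow[OF assms(1)] B by blast
  show "\<forall>s\<in>B. \<forall>s'\<in>B. s \<noteq> s' \<longrightarrow> \<Omega>_of s \<inter> \<Omega>_of s' \<noteq> {} \<longrightarrow> l2_inner (\<phi> s) (\<phi> s') = 0"
    using cluster_orthogonal[OF assms(1)] B by blast
qed (use assms(1) in \<open>simp_all add: cluster_def\<close>)

text \<open>The hypotheses survive the passage to fewer and smaller clusters. In the separation condition this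
  uses disjointness: a remaining tile of the cluster \<open>C I\<close> cannot belong to another \<open>D J\<close>, hence it
  belongs to \<open>D I\<close>.\<close>

lemma (in separated_clusters) subcollection:
  assumes J: "\<J> \<subseteq> \<I>" and D: "\<And>I. I \<in> \<J> \<Longrightarrow> D I \<subseteq> C I"
  shows "separated_clusters (\<Union>I\<in>\<J>. D I) \<J> D \<phi> C0 C1"
proof
  let ?T = "\<Union>I\<in>\<J>. D I"
  have T: "?T \<subseteq> S"
    unfolding S_eq using J D by blast
  show "disjoint_family_on D \<J>"
    using disjoint J D unfolding disjoint_family_on_def by blast
  show "adapted C0 ?T \<phi>"
    using adapted T by (rule adapted_subset)
  show "cluster C0 C1 (D I) \<phi> I" if "I \<in> \<J>" for I
    using that J by (intro cluster_subset[OF clusters D]) blast+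
  show "grid (\<Omega>_of ` ?T)"
    using grid T unfolding grid_def by blast
  show "s' \<in> D I \<or> W_of s' \<inter> I = {}"
    if s: "s \<in> ?T" "s' \<in> ?T" "I \<in> \<J>" "s \<noteq> s'" "s \<in> D I" "\<Omega>_of s \<subseteq> \<Omega>_of s'" for s s' I
  proof (cases "W_of s' \<inter> I = {}")
    case False
    obtain J where J': "J \<in> \<J>" "s' \<in> D J"
      using s(2) by blast
    have "s' \<in> C I"
      using separated[of s s' I] s T J D False by blast
    then have "J = I"
      using shadow_eq[of I s'] shadow_eq[of J s'] J D J' s(3) by blast
    with J' show ?thesis by blast
  qed simp
  show "is_tile s" if "s \<in> ?T" for s
    using that T tiles by blast
  show "centered (W_of s') \<subseteq> centered (W_of s)"
    if "s \<in> ?T" "s' \<in> ?T" "\<Omega>_of s \<subseteq> \<Omega>_of s'" for s s'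
    using that(3) by (rule nested[OF subsetD[OF T that(1)] subsetD[OF T that(2)]])
qed (rule C1 refl)+

text \<open>All hypotheses on the frequency sets are about intersecting and nesting. An encoding that
  preserves both relations therefore preserves the hypotheses.\<close>

locale frequency_encoding = separated_clusters S \<I> C \<phi> C0 C1
  for S :: "('n::finite, 'b) tile set" and \<I> C \<phi> C0 C1 +
  fixes e :: "'b set \<Rightarrow> 'c set"
  assumes e_meet: "s \<in> S \<Longrightarrow> t \<in> S \<Longrightarrow> e (\<Omega>_of s) \<inter> e (\<Omega>_of t) = {} \<longleftrightarrow> \<Omega>_of s \<inter> \<Omega>_of t = {}"
    and e_subset: "s \<in> S \<Longrightarrow> t \<in> S \<Longrightarrow> e (\<Omega>_of s) \<subseteq> e (\<Omega>_of t) \<longleftrightarrow> \<Omega>_of s \<subseteq> \<Omega>_of t"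
begin

definition encode :: "('n, 'b) tile \<Rightarrow> ('n, 'c) tile" where
  "encode s = (W_of s, e (\<Omega>_of s))"

definition \<phi>' :: "('n, 'c) tile \<Rightarrow> real^'n \<Rightarrow> complex" where
  "\<phi>' s = \<phi> (inv_into S encode s)"

lemma encode_simps [simp]: "W_of (encode s) = W_of s" "\<Omega>_of (encode s) = e (\<Omega>_of s)"
  by (simp_all add: encode_def)

lemma inj_encode: "inj_on encode S"
proof (rule inj_onI)
  fix s t assume s: "s \<in> S" and t: "t \<in> S" and eq: "encode s = encode t"
  have "W_of s = W_of t" "e (\<Omega>_of s) = e (\<Omega>_of t)"
    using eq by (simp_all add: encode_def)
  moreover from this have "\<Omega>_of s = \<Omega>_of t"
    using e_subset[OF s t] e_subset[OF t s] by blast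
  ultimately show "s = t"
    by (simp add: prod_eq_iff)
qed

lemma encode_eq_iff: "s \<in> S \<Longrightarrow> t \<in> S \<Longrightarrow> encode s = encode t \<longleftrightarrow> s = t"
  by (rule inj_on_eq_iff[OF inj_encode])

lemma \<phi>'_encode: "s \<in> S \<Longrightarrow> \<phi>' (encode s) = \<phi> s"
  by (simp add: \<phi>'_def inv_into_f_f[OF inj_encode])

lemma infsum_encode:
  assumes "A \<subseteq> S"
  shows "infsum g (encode ` A) = (\<Sum>\<^sub>\<infinity>s\<in>A. g (encode s))"
  using infsum_reindex[OF inj_on_subset[OF inj_encode assms], of g] by (simp add: comp_def)

lemma adapted_encode:
  assumes A: "A \<subseteq> S" and "adapted C0 A \<phi>"
  shows "adapted C0 (encode ` A) \<phi>'"
  unfolding adapted_def ball_simps encode_simps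
proof (intro ballI)
  fix s assume s: "s \<in> A"
  then have eq: "\<phi>' (encode s) = \<phi> s"
    using A \<phi>'_encode by blast
  show "schwartz (\<phi>' (encode s)) \<and> l2_norm (\<phi>' (encode s)) = 1 \<and>
    (\<forall>t\<in>A. e (\<Omega>_of s) \<inter> e (\<Omega>_of t) = {} \<longrightarrow> l2_inner (\<phi>' (encode s)) (\<phi>' (encode t)) = 0) \<and>
    (\<forall>x. cmod (\<phi>' (encode s) x) \<le>
      C0 / sqrt (measure lebesgue (W_of s)) / (1 + \<sigma> x (W_of s)) ^ (2 * CARD('n) + 5))"
    unfolding eq
  proof (intro conjI ballI impI)
    fix t assume t: "t \<in> A" and "e (\<Omega>_of s) \<inter> e (\<Omega>_of t) = {}"
    then have "\<Omega>_of s \<inter> \<Omega>_of t = {}"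
      using e_meet A s by blast
    then have "l2_inner (\<phi> s) (\<phi> t) = 0"
      using assms(2) s t unfolding adapted_def by blast
    then show "l2_inner (\<phi> s) (\<phi>' (encode t)) = 0"
      using t A by (simp add: \<phi>'_encode subsetD)
  qed (use assms(2) s in \<open>unfold adapted_def, blast\<close>)+
qed

lemma tile_set_encode_disjoint:
  assumes "s \<in> S" "t \<in> S"
  shows "tile_set (encode s) \<inter> tile_set (encode t) = {} \<longleftrightarrow> tile_set s \<inter> tile_set t = {}"
  using e_meet[OF assms] by (simp add: tile_set_def Times_Int_Times Sigma_empty_iff)

lemma C_subset_S: "I \<in> \<I> \<Longrightarrow> C I \<subseteq> S"
  using S_eq by blast

lemma cluster_encode:
  assumes I: "I \<in> \<I>"
  shows "cluster C0 C1 (encode ` C I) \<phi>' I"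
proof -
  note cl = clusters[OF I, unfolded cluster_def]
  have sub: "\<And>s. s \<in> C I \<Longrightarrow> s \<in> S"
    using C_subset_S[OF I] by blast
  show ?thesis
    unfolding cluster_def ball_simps encode_simps infsum_encode[OF C_subset_S[OF I]]
  proof (intro conjI ballI impI)
    show "adapted C0 (encode ` C I) \<phi>'"
      using cl by (intro adapted_encode C_subset_S[OF I]) blast
    show "tile_set (encode s) \<inter> tile_set (encode t) = {}"
      if "s \<in> C I" "t \<in> C I" "encode s \<noteq> encode t" for s t
    proof -
      have "s \<noteq> t" using that(3) by blast
      then show ?thesis
        using cluster_disjoint[OF clusters[OF I]] that(1,2) tile_set_encode_disjoint[OF sub sub] by blast
    qed
    show "l2_inner (\<phi>' (encode s)) (\<phi>' (encode t)) = 0"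
      if "s \<in> C I" "t \<in> C I" "encode s \<noteq> encode t" "e (\<Omega>_of s) \<inter> e (\<Omega>_of t) \<noteq> {}" for s t
    proof -
      have "s \<noteq> t" using that(3) by blast
      moreover have "\<Omega>_of s \<inter> \<Omega>_of t \<noteq> {}"
        using that e_meet[OF sub sub] by blast
      ultimately have "l2_inner (\<phi> s) (\<phi> t) = 0"
        using cluster_orthogonal[OF clusters[OF I]] that(1,2) by blast
      then show ?thesis
        using that(1,2) by (simp add: \<phi>'_encode sub)
    qed
  qed (use cl in blast)+
qed

lemma separated_clusters_encode:
  "separated_clusters (encode ` S) \<I> (\<lambda>I. encode ` C I) \<phi>' C0 C1"
proof -
  have "\<forall>s\<in>encode ` S. is_tile s"
    using tiles by (simp add: is_tile_def)
  moreover have "encode ` S = (\<Union>I\<in>\<I>. encode ` C I)"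
    by (simp add: S_eq image_UN)
  moreover have "disjoint_family_on (\<lambda>I. encode ` C I) \<I>"
    unfolding disjoint_family_on_def
  proof (intro ballI impI)
    fix I J assume IJ: "I \<in> \<I>" "J \<in> \<I>" "I \<noteq> J"
    then have "C I \<inter> C J = {}"
      using disjoint unfolding disjoint_family_on_def by blast
    then show "encode ` C I \<inter> encode ` C J = {}"
      using inj_on_image_Int[OF inj_encode C_subset_S[OF IJ(1)] C_subset_S[OF IJ(2)]] by simp
  qed
  moreover have "adapted C0 (encode ` S) \<phi>'"
    using adapted by (intro adapted_encode) auto
  moreover have "grid (\<Omega>_of ` encode ` S)"
    unfolding grid_def ball_simps encode_simps
  proof (intro ballI)
    fix s t assume s: "s \<in> S" and t: "t \<in> S"
    then have "\<Omega>_of s \<inter> \<Omega>_of t = {} \<or> \<Omega>_of s \<subseteq> \<Omega>_of t \<or> \<Omega>_of t \<subseteq> \<Omega>_of s"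
      using grid unfolding grid_def by blast
    then show "e (\<Omega>_of s) \<inter> e (\<Omega>_of t) \<in> {{}, e (\<Omega>_of s), e (\<Omega>_of t)}"
      using e_meet[OF s t] e_subset[OF s t] e_subset[OF t s] by blast
  qed
  moreover have "\<forall>s\<in>encode ` S. \<forall>s'\<in>encode ` S. \<Omega>_of s \<subseteq> \<Omega>_of s' \<longrightarrow>
      centered (W_of s') \<subseteq> centered (W_of s)"
    unfolding ball_simps encode_simps
  proof (intro ballI impI)
    fix s t assume s: "s \<in> S" and t: "t \<in> S" and "e (\<Omega>_of s) \<subseteq> e (\<Omega>_of t)"
    then show "centered (W_of t) \<subseteq> centered (W_of s)"
      by (intro nested[OF s t]) (simp add: e_subset[OF s t])
  qed
  moreover have "\<forall>s\<in>encode ` S. \<forall>s'\<in>encode ` S. \<forall>I\<in>\<I>. s \<noteq> s' \<longrightarrow> s \<in> encode ` C I \<longrightarrow>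
      \<Omega>_of s \<subseteq> \<Omega>_of s' \<longrightarrow> s' \<in> encode ` C I \<or> W_of s' \<inter> I = {}"
    unfolding ball_simps encode_simps
  proof (intro ballI impI)
    fix s t I
    assume s: "s \<in> S" and t: "t \<in> S" and I: "I \<in> \<I>" and ne: "encode s \<noteq> encode t"
      and mem: "encode s \<in> encode ` C I" and sub: "e (\<Omega>_of s) \<subseteq> e (\<Omega>_of t)"
    have "s \<in> C I"
      using mem s C_subset_S[OF I] encode_eq_iff by blast
    moreover have "s \<noteq> t" "\<Omega>_of s \<subseteq> \<Omega>_of t"
      using ne sub e_subset[OF s t] by blast+
    ultimately have "t \<in> C I \<or> W_of t \<inter> I = {}"
      using separated[OF s t I] by blast
    then show "encode t \<in> encode ` C I \<or> W_of t \<inter> I = {}"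
      by blast
  qed
  moreover have "\<forall>I\<in>\<I>. cluster C0 C1 (encode ` C I) \<phi>' I"
    using cluster_encode by blast
  ultimately show ?thesis
    unfolding separated_clusters_iff by (intro conjI C1)
qed

lemma SQ_encode:
  assumes I: "I \<in> \<I>"
  shows "SQ (encode ` C I) \<phi>' I f = SQ (C I) \<phi> I f"
proof -
  have "(\<Sum>\<^sub>\<infinity>s\<in>C I. (cmod (l2_inner f (\<phi>' (encode s))))\<^sup>2)
      = (\<Sum>\<^sub>\<infinity>s\<in>C I. (cmod (l2_inner f (\<phi> s)))\<^sup>2)"
    by (rule infsum_cong) (simp only: \<phi>'_encode[OF subsetD[OF C_subset_S[OF I]]])
  then show ?thesis
    by (simp only: SQ_def infsum_encode[OF C_subset_S[OF I]])
qed

end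

text \<open>For countably many sets, countably many points suffice to witness all nonempty intersections and
  all failures of inclusion. Numbering these points gives the encoding.\<close>

lemma encode_countable_family:
  fixes \<F> :: "'b set set"
  assumes "countable \<F>"
  obtains e :: "'b set \<Rightarrow> nat set"
  where "\<And>X Y. X \<in> \<F> \<Longrightarrow> Y \<in> \<F> \<Longrightarrow> e X \<inter> e Y = {} \<longleftrightarrow> X \<inter> Y = {}"
    and "\<And>X Y. X \<in> \<F> \<Longrightarrow> Y \<in> \<F> \<Longrightarrow> e X \<subseteq> e Y \<longleftrightarrow> X \<subseteq> Y"
proof -
  define P where "P = (\<lambda>(X, Y). SOME p. p \<in> X \<inter> Y) ` (\<F> \<times> \<F>) \<union> (\<lambda>(X, Y). SOME p. p \<in> X - Y) ` (\<F> \<times> \<F>)"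
  have "countable P"
    using assms by (simp add: P_def)
  then have inj: "inj_on (to_nat_on P) P"
    by (rule inj_on_to_nat_on)
  define e where "e = (\<lambda>X. to_nat_on P ` (X \<inter> P))"
  show ?thesis
  proof
    fix X Y assume X: "X \<in> \<F>" and Y: "Y \<in> \<F>"
    have "(SOME p. p \<in> X \<inter> Y) \<in> P"
      using X Y unfolding P_def by force
    then have meet: "X \<inter> Y \<inter> P = {} \<Longrightarrow> X \<inter> Y = {}"
      using some_in_eq[of "X \<inter> Y"] by blast
    have "(SOME p. p \<in> X - Y) \<in> P"
      using X Y unfolding P_def by force
    then have diff: "(X - Y) \<inter> P = {} \<Longrightarrow> X - Y = {}"
      using some_in_eq[of "X - Y"] by blast
    have "e X \<inter> e Y = to_nat_on P ` (X \<inter> Y \<inter> P)"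
      unfolding e_def by (subst inj_on_image_Int[OF inj, symmetric]) auto
    then show "e X \<inter> e Y = {} \<longleftrightarrow> X \<inter> Y = {}"
      using meet by auto
    have "e X \<subseteq> e Y \<longleftrightarrow> X \<inter> P \<subseteq> Y \<inter> P"
      unfolding e_def by (rule inj_on_image_subset_iff[OF inj]) auto
    then show "e X \<subseteq> e Y \<longleftrightarrow> X \<subseteq> Y"
      using diff by blast
  qed
qed

text \<open>It suffices to bound finite partial sums over the shadows. A tile whose function is orthogonal to
  \<open>f\<close> contributes nothing to the square function and can be dropped; only countably many tiles of each
  cluster remain, because the square function converges.\<close>

lemma cluster_estimate_from_nat:
  assumes nat: "cluster_estimate TYPE('n::finite) TYPE(nat) K"
  shows "cluster_estimate TYPE('n) TYPE('b) K"
  unfolding cluster_estimate_iff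
proof (intro allI impI)
  fix S :: "('n, 'b) tile set" and \<I> C \<phi> C0 C1 f lam
  assume "separated_clusters S \<I> C \<phi> C0 C1"
  then interpret separated_clusters S \<I> C \<phi> C0 C1 .
  assume f: "square_integrable f" and lam: "0 < lam"
    and SQ: "\<forall>I\<in>\<I>. lam \<le> SQ (C I) \<phi> I f"
    and coeff: "\<forall>s\<in>S. cmod (l2_inner f (\<phi> s)) \<le> 2 * lam * sqrt (measure lebesgue (W_of s))"
  let ?a = "\<lambda>s. (cmod (l2_inner f (\<phi> s)))\<^sup>2"
  show "(\<Sum>\<^sub>\<infinity>I\<in>\<I>. emeasure lebesgue I)
    \<le> ennreal (1 / lam\<^sup>2 * K * (1 + sqrt C1 * C0\<^sup>2) * (l2_norm f)\<^sup>2)"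
  proof (rule infsum_le_finite_sums)
    fix G assume G: "finite G" "G \<subseteq> \<I>"
    define D where "D = (\<lambda>I. {s \<in> C I. ?a s \<noteq> 0})"
    define T where "T = (\<Union>I\<in>G. D I)"
    have sub: "separated_clusters T G D \<phi> C0 C1"
      unfolding T_def by (rule subcollection[OF G(2)]) (auto simp: D_def)
    have "countable (D I)" if I: "I \<in> G" for I
    proof -
      have "infsum ?a (C I) \<noteq> 0"
        using SQ I G lam by (force simp: SQ_def)
      then have "?a summable_on C I"
        using infsum_not_exists by blast
      then show ?thesis
        unfolding D_def by (rule summable_countable_real)
    qed
    then have "countable T"
      unfolding T_def by (rule countable_UN[OF countable_finite[OF G(1)]])
    then have "countable (\<Omega>_of ` T)"
      by simp
    then obtain e :: "'b set \<Rightarrow> nat set"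
      where e: "\<And>X Y. X \<in> \<Omega>_of ` T \<Longrightarrow> Y \<in> \<Omega>_of ` T \<Longrightarrow> e X \<inter> e Y = {} \<longleftrightarrow> X \<inter> Y = {}"
        "\<And>X Y. X \<in> \<Omega>_of ` T \<Longrightarrow> Y \<in> \<Omega>_of ` T \<Longrightarrow> e X \<subseteq> e Y \<longleftrightarrow> X \<subseteq> Y"
      by (rule encode_countable_family) blast
    interpret E: frequency_encoding T G D \<phi> C0 C1 e
      using sub e by (intro frequency_encoding.intro frequency_encoding_axioms.intro) auto
    have "T \<subseteq> S"
      unfolding T_def S_eq D_def using G(2) by blast
    have large: "lam \<le> SQ (E.encode ` D I) E.\<phi>' I f" if I: "I \<in> G" for I
    proof -
      have "infsum ?a (D I) = infsum ?a (C I)"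
        by (rule infsum_cong_neutral) (auto simp: D_def)
      then have "SQ (D I) \<phi> I f = SQ (C I) \<phi> I f"
        by (simp add: SQ_def)
      then show ?thesis
        using SQ I G(2) E.SQ_encode[OF I] by (metis subsetD)
    qed
    have small: "cmod (l2_inner f (E.\<phi>' s)) \<le> 2 * lam * sqrt (measure lebesgue (W_of s))"
      if "s \<in> E.encode ` T" for s
    proof -
      obtain t where t: "t \<in> T" "s = E.encode t"
        using \<open>s \<in> E.encode ` T\<close> by blast
      then show ?thesis
        using bspec[OF coeff subsetD[OF \<open>T \<subseteq> S\<close> t(1)]] by (simp add: E.\<phi>'_encode)
    qed
    have "(\<Sum>\<^sub>\<infinity>I\<in>G. emeasure lebesgue I)
        \<le> ennreal (1 / lam\<^sup>2 * K * (1 + sqrt C1 * C0\<^sup>2) * (l2_norm f)\<^sup>2)"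
      by (rule nat[unfolded cluster_estimate_iff, rule_format,
            OF E.separated_clusters_encode f lam large small])
    then show "(\<Sum>I\<in>G. emeasure lebesgue I)
        \<le> ennreal (1 / lam\<^sup>2 * K * (1 + sqrt C1 * C0\<^sup>2) * (l2_norm f)\<^sup>2)"
      using G(1) by simp
  qed (auto intro: nonneg_summable_on_complete)
qed

theorem theorem1p11:
  shows "(\<exists>K. cluster_estimate TYPE('n::finite) TYPE('b) K) \<and>
         (\<forall>K. cluster_estimate TYPE('n) TYPE(nat) K \<longrightarrow> cluster_estimate TYPE('n) TYPE('b) K)"
  using cluster_estimate_holds cluster_estimate_from_nat by blast

end
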